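(* Let $(X_k)_{k\ge1}$, $\mu$, $H=L^2(\mathbb R,\mathcal B(\mathbb R),\mu)$, $(e_j)_{j\ge1}$, $\Phi$, $\varphi^{(1,1)}$, $\varphi^{(2)}$ be as defined in the context, and let $h,g\in H$. Let $0=t_0^n<t_1^n<\dots<t_n^n=1$ ($n\ge1$) be a sequence of partitions of $[0,1]$ whose mesh tends to $0$. Then, as $n\to\infty$, $$\sum_{k=0}^{n-1}\Phi\bigl(h1_{]0,t_k^n]}\bigr)\,\Phi\bigl(g1_{]t_k^n,t_{k+1}^n]}\bigr)\longrightarrow \varphi^{(1,1)}\bigl(h\otimes g\,1_C+g\otimes h\,1_{\widetilde C}\bigr)+\varphi^{(2)}\bigl(h\otimes g\,1_C\bigr)$$ in $L^2(E,\mathcal E,\nu)$, where $C=\{(x,y)\in\mathbb R^2:0\le x<y\le1\}$ and $\widetilde C=\{(x,y)\in\mathbb R^2:0\le y<x\le1\}$.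
   Context: Setting: $E$ is a normed vector space, $(E,\mathcal E,\nu)$ a probability space, and $(X_k)_{k\ge1}$ a sequence of independent, centered, variance-one real random variables on it such that for every $p>1$ there is a constant $K_p$ with $\sup_k E|X_k|^p<K_p$. $\mu$ is a diffuse (atomless) probability measure on $(\mathbb R,\mathcal B(\mathbb R))$, $H=L^2(\mathbb R,\mathcal B(\mathbb R),\mu)$ (real), with inner product $\langle\cdot,\cdot\rangle$ and Hilbert basis $(e_j)_{j\ge1}$. $H\otimes H$ is identified with $L^2(\mu\otimes\mu)$, with $(h\otimes g)(x,y)=h(x)g(y)$ and inner product also written $\langle\cdot,\cdot\rangle$. Operators: $\Phi:H\to L^2(\nu)$, $\Phi(h)=\sum_{k\ge1}\langle h,e_k\rangle X_k$. For $f\in H\otimes H$, $$\varphi^{(1,1)}(f)=\sum_{j\ge2}\Bigl(\sum_{k=1}^{j-1}\langle f,e_j\otimes e_k\rangle X_k\Bigr)X_j,\qquad \varphi^{(2)}(f)=\sum_{j\ge1}\langle f,e_j\otimes e_j\rangle(X_j^2-1),$$ both series (partial sums in $j$) converging in $L^2(\nu)$. *)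

theory Defs
  imports "HOL-Probability.Probability"
begin

text \<open>
  Elements of a real \<open>L\<^sup>2\<close> space are represented by square-integrable functions rather than by
  classes modulo almost-everywhere equality.
\<close>

definition L2 :: "'a measure \<Rightarrow> ('a \<Rightarrow> real) set" where
  "L2 M = {f \<in> borel_measurable M. integrable M (\<lambda>x. (f x)\<^sup>2)}"

definition L2_inner :: "'a measure \<Rightarrow> ('a \<Rightarrow> real) \<Rightarrow> ('a \<Rightarrow> real) \<Rightarrow> real" where
  "L2_inner M f g = (\<integral>x. f x * g x \<partial>M)"

definition L2_norm :: "'a measure \<Rightarrow> ('a \<Rightarrow> real) \<Rightarrow> real" where
  "L2_norm M f = sqrt (L2_inner M f f)"

text \<open>
  Membership in \<open>L2 M\<close> is part of convergence, since \<open>L2_norm M\<close> is meaningless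
  (possibly \<open>0\<close>) outside \<open>L2 M\<close>.
\<close>

definition L2_tendsto :: "'a measure \<Rightarrow> (nat \<Rightarrow> 'a \<Rightarrow> real) \<Rightarrow> ('a \<Rightarrow> real) \<Rightarrow> bool" where
  "L2_tendsto M F f \<longleftrightarrow>
     (\<forall>n. F n \<in> L2 M) \<and> f \<in> L2 M \<and> (\<lambda>n. L2_norm M (\<lambda>x. F n x - f x)) \<longlonglongrightarrow> 0"

text \<open>
  Sum in \<open>L\<^sup>2\<close> of the series of the \<open>F j\<close> with \<open>j \<ge> m\<close>: some representative of the limit of the
  partial sums, which is unique up to almost-everywhere equality. If the series does not
  converge in \<open>L\<^sup>2\<close>, the value is unspecified.
\<close>

definition L2_series :: "'a measure \<Rightarrow> nat \<Rightarrow> (nat \<Rightarrow> 'a \<Rightarrow> real) \<Rightarrow> 'a \<Rightarrow> real" where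
  "L2_series M m F = (SOME f. L2_tendsto M (\<lambda>N x. \<Sum>j=m..N. F j x) f)"

text \<open>
  Sequences are indexed by the integers \<open>k \<ge> 1\<close>; the values at index \<open>0\<close> are never used.
\<close>

definition hilbert_basis :: "'a measure \<Rightarrow> (nat \<Rightarrow> 'a \<Rightarrow> real) \<Rightarrow> bool" where
  "hilbert_basis M e \<longleftrightarrow>
     (\<forall>j\<ge>1. e j \<in> L2 M) \<and>
     (\<forall>j\<ge>1. \<forall>k\<ge>1. L2_inner M (e j) (e k) = (if j = k then 1 else 0)) \<and>
     (\<forall>f\<in>L2 M. \<forall>\<epsilon>>0. \<exists>N c. L2_norm M (\<lambda>x. f x - (\<Sum>j=1..N. c j * e j x)) < \<epsilon>)"

definition tensor :: "('a \<Rightarrow> real) \<Rightarrow> ('b \<Rightarrow> real) \<Rightarrow> 'a \<times> 'b \<Rightarrow> real" where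
  "tensor h g = (\<lambda>(x, y). h x * g y)"

definition Phi :: "'e measure \<Rightarrow> (nat \<Rightarrow> 'e \<Rightarrow> real) \<Rightarrow> 'a measure \<Rightarrow> (nat \<Rightarrow> 'a \<Rightarrow> real) \<Rightarrow>
    ('a \<Rightarrow> real) \<Rightarrow> 'e \<Rightarrow> real" where
  "Phi \<nu> X \<mu> e h = L2_series \<nu> 1 (\<lambda>k \<omega>. L2_inner \<mu> h (e k) * X k \<omega>)"

definition phi11 :: "'e measure \<Rightarrow> (nat \<Rightarrow> 'e \<Rightarrow> real) \<Rightarrow> 'a measure \<Rightarrow> (nat \<Rightarrow> 'a \<Rightarrow> real) \<Rightarrow>
    ('a \<times> 'a \<Rightarrow> real) \<Rightarrow> 'e \<Rightarrow> real" where
  "phi11 \<nu> X \<mu> e f = L2_series \<nu> 2 (\<lambda>j \<omega>.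
     (\<Sum>k=1..j-1. L2_inner (\<mu> \<Otimes>\<^sub>M \<mu>) f (tensor (e j) (e k)) * X k \<omega>) * X j \<omega>)"

definition phi2 :: "'e measure \<Rightarrow> (nat \<Rightarrow> 'e \<Rightarrow> real) \<Rightarrow> 'a measure \<Rightarrow> (nat \<Rightarrow> 'a \<Rightarrow> real) \<Rightarrow>
    ('a \<times> 'a \<Rightarrow> real) \<Rightarrow> 'e \<Rightarrow> real" where
  "phi2 \<nu> X \<mu> e f = L2_series \<nu> 1 (\<lambda>j \<omega>.
     L2_inner (\<mu> \<Otimes>\<^sub>M \<mu>) f (tensor (e j) (e j)) * ((X j \<omega>)\<^sup>2 - 1))"

definition C_upper :: "(real \<times> real) set" where
  "C_upper = {(x, y). 0 \<le> x \<and> x < y \<and> y \<le> 1}"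

definition C_lower :: "(real \<times> real) set" where
  "C_lower = {(x, y). 0 \<le> y \<and> y < x \<and> x \<le> 1}"

end

theory Submission
  imports Defs
begin

text \<open>
  The operators \<open>phi11\<close> and \<open>phi2\<close> are bounded from \<open>L\<^sup>2(\<mu> \<otimes> \<mu>)\<close> to \<open>L\<^sup>2(\<nu>)\<close>: their terms are
  orthogonal with controlled norms (a fourth moment bound suffices), and Bessel's inequality
  controls the coefficients. Multiplying out partial sums gives
  \<open>Phi h * Phi g = phi11 (h \<otimes> g + g \<otimes> h) + phi2 (h \<otimes> g) + \<langle>h, g\<rangle>\<close> almost everywhere. In the
  Riemann sum the two factors of each summand have disjoint supports, so the inner products vanish and the
  sum is \<open>phi11\<close> and \<open>phi2\<close> of \<open>h \<otimes> g\<close> cut off by the indicator of a staircase region inside \<open>C\<close>.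
  These kernels converge to \<open>h \<otimes> g 1\<^sub>C\<close> by dominated convergence, the axis \<open>x = 0\<close> being a null set.
\<close>

subsection \<open>Square-integrable functions\<close>

text \<open>\<open>phi11\<close> reads only coefficients with \<open>k < j\<close>, so expanding a
  product meets each pair of distinct indices twice and calls for the symmetrised kernel, whereas
  \<open>phi2\<close> reads the diagonal, which symmetrising would merely double. Hence both
  triangles occur in \<open>phi11\<close> but only \<open>C_upper\<close> in \<open>phi2\<close>.
  The constant in the product formula comes from centring the squares of the \<open>X j\<close>: at
  each finite stage it is a partial Parseval sum. The values of \<open>Phi\<close>,
  \<open>phi11\<close> and \<open>phi2\<close> are representatives picked by a choice operator.
  Linearity is therefore exact only for partial sums, and identities between limits hold only almost
  everywhere. Moreover a product of two values of \<open>Phi\<close> is a priori just integrable;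
  its square integrability is read off from the chaos side of the product formula. The whole Riemann
  sum becomes one kernel, so the limit in \<open>n\<close> is taken in L2 of the product measure and
  no error accumulates over the \<open>n\<close> summands.\<close>

lemma LIMSEQ_zero_bounded:
  fixes f g :: "nat \<Rightarrow> real"
  assumes "\<And>n. 0 \<le> f n" "\<And>n. f n \<le> g n" "g \<longlonglongrightarrow> 0"
  shows "f \<longlonglongrightarrow> 0"
  by (rule Lim_null_comparison[OF _ assms(3)]) (use assms in auto)

lemma L2_measurable [measurable_dest]: "f \<in> L2 M \<Longrightarrow> f \<in> borel_measurable M"
  by (simp add: L2_def)

lemma L2_square_integrable: "f \<in> L2 M \<Longrightarrow> integrable M (\<lambda>x. (f x)\<^sup>2)"
  by (simp add: L2_def)

lemma L2_I: "f \<in> borel_measurable M \<Longrightarrow> integrable M (\<lambda>x. (f x)\<^sup>2) \<Longrightarrow> f \<in> L2 M"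
  by (simp add: L2_def)

lemma L2_bound:
  assumes "f \<in> L2 M" "g \<in> borel_measurable M" "\<And>x. x \<in> space M \<Longrightarrow> \<bar>g x\<bar> \<le> \<bar>f x\<bar>"
  shows "g \<in> L2 M"
proof (rule L2_I)
  have "(g x)\<^sup>2 \<le> (f x)\<^sup>2" if "x \<in> space M" for x
    using assms(3)[OF that] by (simp add: abs_le_square_iff)
  then show "integrable M (\<lambda>x. (g x)\<^sup>2)"
    using assms by (intro Bochner_Integration.integrable_bound[OF L2_square_integrable[OF assms(1)]]) auto
qed (use assms in auto)

lemma L2_mult_integrable:
  assumes f: "f \<in> L2 M" and g: "g \<in> L2 M"
  shows "integrable M (\<lambda>x. f x * g x)"
proof (rule Bochner_Integration.integrable_bound)
  show "integrable M (\<lambda>x. (f x)\<^sup>2 + (g x)\<^sup>2)"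
    using f g by (intro Bochner_Integration.integrable_add L2_square_integrable)
  have "\<bar>a * b\<bar> \<le> a\<^sup>2 + b\<^sup>2" for a b :: real
  proof -
    have "2 * \<bar>a * b\<bar> \<le> a\<^sup>2 + b\<^sup>2"
      using sum_squares_bound[of "\<bar>a\<bar>" "\<bar>b\<bar>"] by (simp add: abs_mult)
    then show ?thesis
      using abs_ge_zero[of "a * b"] by linarith
  qed
  then show "AE x in M. norm (f x * g x) \<le> norm ((f x)\<^sup>2 + (g x)\<^sup>2)"
    by (auto simp: real_norm_def)
qed (use L2_measurable[OF f] L2_measurable[OF g] in measurable)

lemma L2_add: "f \<in> L2 M \<Longrightarrow> g \<in> L2 M \<Longrightarrow> (\<lambda>x. f x + g x) \<in> L2 M"
  using L2_mult_integrable[of f M g] unfolding L2_def by (auto simp: power2_sum mult.assoc)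

lemma L2_cmult: "f \<in> L2 M \<Longrightarrow> (\<lambda>x. c * f x) \<in> L2 M"
  unfolding L2_def by (auto simp: power_mult_distrib)

lemma L2_diff: "f \<in> L2 M \<Longrightarrow> g \<in> L2 M \<Longrightarrow> (\<lambda>x. f x - g x) \<in> L2 M"
  using L2_add[OF _ L2_cmult[of g M "-1"], of f] by simp

lemma L2_abs: "f \<in> L2 M \<Longrightarrow> (\<lambda>x. \<bar>f x\<bar>) \<in> L2 M"
  unfolding L2_def by auto

lemma L2_zero: "(\<lambda>x. 0) \<in> L2 M"
  by (simp add: L2_def)

lemma L2_sum: "(\<And>i. i \<in> I \<Longrightarrow> f i \<in> L2 M) \<Longrightarrow> (\<lambda>x. \<Sum>i\<in>I. f i x) \<in> L2 M"
  by (induction I rule: infinite_finite_induct) (simp_all add: L2_zero L2_add)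

lemma L2_mult_indicator:
  "f \<in> L2 M \<Longrightarrow> A \<in> sets M \<Longrightarrow> (\<lambda>x. f x * indicator A x) \<in> L2 M"
  by (rule L2_bound[of f]) (auto simp: indicator_def)

lemma L2_inner_add_left:
  "f \<in> L2 M \<Longrightarrow> g \<in> L2 M \<Longrightarrow> u \<in> L2 M \<Longrightarrow>
    L2_inner M (\<lambda>x. f x + g x) u = L2_inner M f u + L2_inner M g u"
  unfolding L2_inner_def by (simp add: distrib_right L2_mult_integrable)

lemma L2_inner_diff_left:
  "f \<in> L2 M \<Longrightarrow> g \<in> L2 M \<Longrightarrow> u \<in> L2 M \<Longrightarrow>
    L2_inner M (\<lambda>x. f x - g x) u = L2_inner M f u - L2_inner M g u"
  unfolding L2_inner_def by (simp add: left_diff_distrib L2_mult_integrable)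

lemma L2_inner_sum_left:
  "(\<And>i. i \<in> I \<Longrightarrow> f i \<in> L2 M) \<Longrightarrow> u \<in> L2 M \<Longrightarrow>
    L2_inner M (\<lambda>x. \<Sum>i\<in>I. f i x) u = (\<Sum>i\<in>I. L2_inner M (f i) u)"
  unfolding L2_inner_def
  by (simp add: sum_distrib_right L2_mult_integrable Bochner_Integration.integral_sum)

lemma L2_inner_cmult_left: "L2_inner M (\<lambda>x. c * f x) u = c * L2_inner M f u"
  unfolding L2_inner_def by (simp add: mult.assoc)

lemma L2_inner_cmult_right: "L2_inner M f (\<lambda>x. c * u x) = c * L2_inner M f u"
  unfolding L2_inner_def by (simp add: mult.left_commute)

lemma L2_inner_commute: "L2_inner M f g = L2_inner M g f"
  unfolding L2_inner_def by (simp add: mult.commute)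

lemma L2_norm_power2: "(L2_norm M f)\<^sup>2 = L2_inner M f f"
  unfolding L2_norm_def L2_inner_def by simp

lemma L2_norm_nonneg [simp]: "0 \<le> L2_norm M f"
  unfolding L2_norm_def L2_inner_def by simp

lemma L2_norm_minus_commute: "L2_norm M (\<lambda>x. f x - g x) = L2_norm M (\<lambda>x. g x - f x)"
  unfolding L2_norm_def L2_inner_def by (simp add: algebra_simps)

section \<open>Norm expansions, Cauchy-Schwarz and the triangle inequality\<close>

lemma L2_norm_diff_power2:
  assumes "f \<in> L2 M" "g \<in> L2 M"
  shows "(L2_norm M (\<lambda>x. f x - g x))\<^sup>2 = (L2_norm M f)\<^sup>2 - 2 * L2_inner M f g + (L2_norm M g)\<^sup>2"
proof -
  have d: "(\<lambda>x. f x - g x) \<in> L2 M" using assms by (rule L2_diff)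
  have "L2_inner M (\<lambda>x. f x - g x) (\<lambda>x. f x - g x) =
      (L2_inner M f f - L2_inner M g f) - (L2_inner M f g - L2_inner M g g)"
    using L2_inner_diff_left[OF assms d] L2_inner_diff_left[OF assms assms(1)]
      L2_inner_diff_left[OF assms assms(2)]
    by (simp add: L2_inner_commute[of M f "\<lambda>x. f x - g x"] L2_inner_commute[of M g "\<lambda>x. f x - g x"])
  then show ?thesis
    by (simp add: L2_norm_power2 L2_inner_commute[of M g f])
qed

lemma L2_norm_add_power2:
  assumes "f \<in> L2 M" "g \<in> L2 M"
  shows "(L2_norm M (\<lambda>x. f x + g x))\<^sup>2 = (L2_norm M f)\<^sup>2 + 2 * L2_inner M f g + (L2_norm M g)\<^sup>2"
proof -
  have d: "(\<lambda>x. f x + g x) \<in> L2 M" using assms by (rule L2_add)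
  have "L2_inner M (\<lambda>x. f x + g x) (\<lambda>x. f x + g x) =
      (L2_inner M f f + L2_inner M g f) + (L2_inner M f g + L2_inner M g g)"
    using L2_inner_add_left[OF assms d] L2_inner_add_left[OF assms assms(1)]
      L2_inner_add_left[OF assms assms(2)]
    by (simp add: L2_inner_commute[of M f "\<lambda>x. f x + g x"] L2_inner_commute[of M g "\<lambda>x. f x + g x"])
  then show ?thesis
    by (simp add: L2_norm_power2 L2_inner_commute[of M g f])
qed

lemma L2_Cauchy_Schwarz:
  assumes "f \<in> L2 M" "g \<in> L2 M"
  shows "\<bar>L2_inner M f g\<bar> \<le> L2_norm M f * L2_norm M g"
proof -
  let ?a = "(L2_norm M f)\<^sup>2" and ?b = "L2_inner M f g" and ?c = "(L2_norm M g)\<^sup>2"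
  have q: "0 \<le> ?a - 2 * (s * ?b) + s\<^sup>2 * ?c" for s
  proof -
    have "(L2_norm M (\<lambda>x. s * g x))\<^sup>2 = s\<^sup>2 * ?c"
      by (simp only: L2_norm_power2 L2_inner_cmult_left L2_inner_cmult_right)
        (simp add: power2_eq_square)
    moreover have "L2_inner M f (\<lambda>x. s * g x) = s * ?b"
      by (rule L2_inner_cmult_right)
    ultimately have "(L2_norm M (\<lambda>x. f x - s * g x))\<^sup>2 = ?a - 2 * (s * ?b) + s\<^sup>2 * ?c"
      using L2_norm_diff_power2[OF assms(1) L2_cmult[OF assms(2), of s]] by simp
    then show ?thesis by (metis zero_le_power2)
  qed
  have "?b\<^sup>2 \<le> ?a * ?c"
  proof (cases "?c = 0")
    case True
    have "?b = 0"
    proof (rule ccontr)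
      assume "?b \<noteq> 0"
      \<comment> \<open>With a vanishing leading coefficient the quadratic is affine in
        \<open>s\<close>; this \<open>s\<close> gives it the value -1.\<close>
      then show False using q[of "(?a + 1) / (2 * ?b)"] True by simp
    qed
    then show ?thesis using True by simp
  next
    case False
    then have c: "?c > 0" by simp
    have "0 \<le> ?c * (?a - 2 * ((?b / ?c) * ?b) + (?b / ?c)\<^sup>2 * ?c)"
      using q[of "?b / ?c"] c by simp
    also have "\<dots> = ?a * ?c - ?b\<^sup>2"
      using False by (simp add: field_simps power2_eq_square)
    finally show ?thesis by simp
  qed
  then have "?b\<^sup>2 \<le> (L2_norm M f * L2_norm M g)\<^sup>2"
    by (simp add: power_mult_distrib)
  then show ?thesis
    by (simp add: abs_le_square_iff[symmetric])
qed

lemma L2_norm_triangle: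
  assumes "f \<in> L2 M" "g \<in> L2 M"
  shows "L2_norm M (\<lambda>x. f x + g x) \<le> L2_norm M f + L2_norm M g"
proof (rule power2_le_imp_le)
  show "(L2_norm M (\<lambda>x. f x + g x))\<^sup>2 \<le> (L2_norm M f + L2_norm M g)\<^sup>2"
    using L2_norm_add_power2[OF assms] L2_Cauchy_Schwarz[OF assms] by (simp add: power2_sum)
qed simp

lemma L2_norm_triangle_diff:
  assumes "f \<in> L2 M" "g \<in> L2 M" "u \<in> L2 M"
  shows "L2_norm M (\<lambda>x. f x - u x) \<le> L2_norm M (\<lambda>x. f x - g x) + L2_norm M (\<lambda>x. g x - u x)"
  using L2_norm_triangle[OF L2_diff[OF assms(1,2)] L2_diff[OF assms(2,3)]] by simp

text \<open>Taking absolute values leaves the norms unchanged, so Cauchy-Schwarz also controls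
  products in L1.\<close>

lemma L2_abs_mult_le:
  assumes "f \<in> L2 M" "g \<in> L2 M"
  shows "(\<integral>x. \<bar>f x * g x\<bar> \<partial>M) \<le> L2_norm M f * L2_norm M g"
proof -
  have "L2_norm M (\<lambda>x. \<bar>u x\<bar>) = L2_norm M u" for u
    by (simp add: L2_norm_def L2_inner_def)
  then show ?thesis
    using L2_Cauchy_Schwarz[OF L2_abs[OF assms(1)] L2_abs[OF assms(2)]]
    by (simp add: L2_inner_def abs_mult)
qed

section \<open>Convergence in L2\<close>

lemma L2_tendstoD:
  assumes "L2_tendsto M F f"
  shows "F n \<in> L2 M" "f \<in> L2 M" "(\<lambda>n. L2_norm M (\<lambda>x. F n x - f x)) \<longlonglongrightarrow> 0"
  using assms by (auto simp: L2_tendsto_def)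

lemma L2_tendsto_norm_bounded:
  assumes "L2_tendsto M F f" "\<And>n. L2_norm M (F n) \<le> b"
  shows "L2_norm M f \<le> b"
proof -
  note F = L2_tendstoD[OF assms(1)]
  have "L2_norm M f \<le> L2_norm M (\<lambda>x. F n x - f x) + b" for n
    using L2_norm_triangle_diff[OF F(2,1) L2_zero, of n] assms(2)[of n]
      L2_norm_minus_commute[of M "F n" f] by simp
  moreover have "(\<lambda>n. L2_norm M (\<lambda>x. F n x - f x) + b) \<longlonglongrightarrow> 0 + b"
    by (intro tendsto_intros F)
  ultimately have "L2_norm M f \<le> 0 + b"
    by (intro LIMSEQ_le_const) auto
  then show ?thesis by simp
qed

lemma L2_tendsto_diff:
  assumes "L2_tendsto M F f" "L2_tendsto M G g"
  shows "L2_tendsto M (\<lambda>n x. F n x - G n x) (\<lambda>x. f x - g x)"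
proof -
  note F = L2_tendstoD[OF assms(1)] and G = L2_tendstoD[OF assms(2)]
  have "L2_norm M (\<lambda>x. (F n x - G n x) - (f x - g x)) \<le>
      L2_norm M (\<lambda>x. F n x - f x) + L2_norm M (\<lambda>x. G n x - g x)" for n
    using L2_norm_triangle[OF L2_diff[OF F(1,2)] L2_diff[OF G(2,1)], of n n]
      L2_norm_minus_commute[of M "G n" g] by (simp add: algebra_simps)
  then have "(\<lambda>n. L2_norm M (\<lambda>x. (F n x - G n x) - (f x - g x))) \<longlonglongrightarrow> 0"
    by (rule LIMSEQ_zero_bounded[OF L2_norm_nonneg]) (use tendsto_add[OF F(3) G(3)] in simp)
  then show ?thesis
    using F G by (auto simp: L2_tendsto_def L2_diff)
qed

lemma L2_tendsto_add:
  assumes "L2_tendsto M F f" "L2_tendsto M G g"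
  shows "L2_tendsto M (\<lambda>n x. F n x + G n x) (\<lambda>x. f x + g x)"
proof -
  have "L2_tendsto M (\<lambda>n x. 0) (\<lambda>x. 0)"
    by (simp add: L2_tendsto_def L2_zero L2_norm_def L2_inner_def)
  from L2_tendsto_diff[OF assms(1) L2_tendsto_diff[OF this assms(2)]] show ?thesis
    by simp
qed

text \<open>A product of two square-integrable functions need not be square-integrable, so
  membership of \<open>F n\<close> in \<open>L2 M\<close> is not assumed: it is inherited from
  \<open>G n\<close>. This is how the Riemann sums are seen to lie in L2.\<close>

lemma L2_tendsto_cong_AE:
  assumes "L2_tendsto M G g" "\<And>n. F n \<in> borel_measurable M" "\<And>n. AE x in M. F n x = G n x"
  shows "L2_tendsto M F g"
proof -
  note G = L2_tendstoD[OF assms(1)]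
  have [measurable]: "F n \<in> borel_measurable M" "G n \<in> borel_measurable M" "g \<in> borel_measurable M" for n
    using assms(2) G by (auto dest: L2_measurable)
  have "F n \<in> L2 M" for n
  proof (rule L2_I)
    show "integrable M (\<lambda>x. (F n x)\<^sup>2)"
      using assms(3)[of n] L2_square_integrable[OF G(1)[of n]]
      by (subst integrable_cong_AE[of _ _ "\<lambda>x. (G n x)\<^sup>2"]) auto
  qed simp
  moreover have "L2_norm M (\<lambda>x. F n x - g x) = L2_norm M (\<lambda>x. G n x - g x)" for n
    using assms(3)[of n] unfolding L2_norm_def L2_inner_def
    by (intro arg_cong[of _ _ sqrt] integral_cong_AE) auto
  ultimately show ?thesis
    using G by (simp add: L2_tendsto_def)
qed

section \<open>Completeness over a probability space\<close>

lemma (in prob_space) L2_integrable: "f \<in> L2 M \<Longrightarrow> integrable M f"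
  by (auto simp: L2_def intro: square_integrable_imp_integrable)

lemma (in prob_space) L2_const: "(\<lambda>x. c) \<in> L2 M"
  by (simp add: L2_def)

lemma (in prob_space) L1_le_L2_norm: "f \<in> L2 M \<Longrightarrow> (\<integral>x. \<bar>f x\<bar> \<partial>M) \<le> L2_norm M f"
  using L2_abs_mult_le[OF _ L2_const, of f 1] by (simp add: L2_norm_def L2_inner_def prob_space)

text \<open>Riesz-Fischer. On a probability space the L1 norm is at most the L2 norm, so the
  sequence is Cauchy in L1 and a subsequence converges almost everywhere. Fatou's lemma along it
  turns the Cauchy estimate into a bound on the distance to the limit.\<close>

lemma (in prob_space) L2_complete:
  assumes F: "\<And>n. F n \<in> L2 M"
    and Cauchy: "\<And>\<epsilon>. \<epsilon> > 0 \<Longrightarrow> \<exists>N. \<forall>m\<ge>N. \<forall>n\<ge>N. L2_norm M (\<lambda>x. F m x - F n x) < \<epsilon>"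
  shows "\<exists>f. L2_tendsto M F f"
proof -
  note [measurable] = L2_measurable[OF F]
  have L1: "\<exists>N. \<forall>i\<ge>N. \<forall>j\<ge>N. (LINT x|M. norm (F i x - F j x)) < \<epsilon>" if "\<epsilon> > 0" for \<epsilon>
  proof -
    obtain N where N: "\<forall>m\<ge>N. \<forall>n\<ge>N. L2_norm M (\<lambda>x. F m x - F n x) < \<epsilon>"
      using Cauchy[OF \<open>\<epsilon> > 0\<close>] by blast
    then show ?thesis
      using N by (intro exI[of _ N] allI impI)
        (simp, blast intro: le_less_trans[OF L1_le_L2_norm[OF L2_diff[OF F F]]])
  qed
  obtain r where r: "strict_mono r" "AE x in M. Cauchy (\<lambda>i. F (r i) x)"
    by (rule cauchy_L1_AE_cauchy_subseq[OF L2_integrable[OF F] L1])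
  define f where "f x = lim (\<lambda>i. F (r i) x)" for x
  have [measurable]: "f \<in> borel_measurable M" unfolding f_def by measurable
  have lim: "AE x in M. (\<lambda>i. F (r i) x) \<longlonglongrightarrow> f x"
    using r(2) by eventually_elim (simp add: f_def Cauchy_convergent convergent_LIMSEQ_iff[symmetric])
  have nn: "(\<integral>\<^sup>+x. ennreal ((g x)\<^sup>2) \<partial>M) = ennreal ((L2_norm M g)\<^sup>2)" if "g \<in> L2 M" for g
    unfolding L2_norm_power2 L2_inner_def
    using nn_integral_eq_integral[OF L2_square_integrable[OF that]] by (simp add: power2_eq_square)
  have key: "(\<lambda>x. F n x - f x) \<in> L2 M \<and> L2_norm M (\<lambda>x. F n x - f x) \<le> \<epsilon>"
    if "\<epsilon> > 0" and N: "\<forall>m\<ge>N. \<forall>n\<ge>N. L2_norm M (\<lambda>x. F m x - F n x) < \<epsilon>" and n: "n \<ge> N" for \<epsilon> n N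
  proof -
    have "(\<integral>\<^sup>+x. ennreal ((F n x - f x)\<^sup>2) \<partial>M) = (\<integral>\<^sup>+x. liminf (\<lambda>i. ennreal ((F n x - F (r i) x)\<^sup>2)) \<partial>M)"
    proof (rule nn_integral_cong_AE, use lim in eventually_elim)
      fix x assume "(\<lambda>i. F (r i) x) \<longlonglongrightarrow> f x"
      then have "(\<lambda>i. ennreal ((F n x - F (r i) x)\<^sup>2)) \<longlonglongrightarrow> ennreal ((F n x - f x)\<^sup>2)"
        by (intro tendsto_intros)
      then show "ennreal ((F n x - f x)\<^sup>2) = liminf (\<lambda>i. ennreal ((F n x - F (r i) x)\<^sup>2))"
        by (intro lim_imp_Liminf[OF sequentially_bot, symmetric])
    qed
    also have "\<dots> \<le> liminf (\<lambda>i. \<integral>\<^sup>+x. ennreal ((F n x - F (r i) x)\<^sup>2) \<partial>M)"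
      by (intro nn_integral_liminf) measurable
    also have "\<dots> \<le> limsup (\<lambda>i. \<integral>\<^sup>+x. ennreal ((F n x - F (r i) x)\<^sup>2) \<partial>M)"
      by (intro Liminf_le_Limsup) simp
    also have "\<dots> \<le> ennreal (\<epsilon>\<^sup>2)"
    proof (rule Limsup_bounded)
      show "\<forall>\<^sub>F i in sequentially. (\<integral>\<^sup>+x. ennreal ((F n x - F (r i) x)\<^sup>2) \<partial>M) \<le> ennreal (\<epsilon>\<^sup>2)"
      proof (rule eventually_sequentiallyI[of N])
        fix i assume "N \<le> i"
        then have "r i \<ge> N" using seq_suble[OF r(1), of i] by simp
        then have "L2_norm M (\<lambda>x. F n x - F (r i) x) < \<epsilon>" using N n by blast
        then have "(L2_norm M (\<lambda>x. F n x - F (r i) x))\<^sup>2 \<le> \<epsilon>\<^sup>2"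
          by (intro power_mono) auto
        then show "(\<integral>\<^sup>+x. ennreal ((F n x - F (r i) x)\<^sup>2) \<partial>M) \<le> ennreal (\<epsilon>\<^sup>2)"
          by (simp add: nn[OF L2_diff[OF F F]] ennreal_leI)
      qed
    qed
    finally have le: "(\<integral>\<^sup>+x. ennreal ((F n x - f x)\<^sup>2) \<partial>M) \<le> ennreal (\<epsilon>\<^sup>2)" .
    then have mem: "(\<lambda>x. F n x - f x) \<in> L2 M"
      by (intro L2_I integrableI_bounded) (auto simp: top_unique less_top intro: le_less_trans)
    have "(L2_norm M (\<lambda>x. F n x - f x))\<^sup>2 \<le> \<epsilon>\<^sup>2"
      using le unfolding nn[OF mem] by (simp add: ennreal_le_iff)
    then show ?thesis using mem \<open>\<epsilon> > 0\<close> by (auto intro: power2_le_imp_le)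
  qed
  obtain N1 where "\<forall>m\<ge>N1. \<forall>n\<ge>N1. L2_norm M (\<lambda>x. F m x - F n x) < 1"
    using Cauchy[of 1] by auto
  then have "(\<lambda>x. F N1 x - f x) \<in> L2 M" using key[of 1 N1 N1] by simp
  \<comment> \<open>Square integrability of \<open>f\<close> is obtained only now, by subtracting
    this difference from \<open>F N1\<close>.\<close>
  then have "f \<in> L2 M" using L2_diff[OF F[of N1]] by force
  moreover have "(\<lambda>n. L2_norm M (\<lambda>x. F n x - f x)) \<longlonglongrightarrow> 0"
  proof (rule LIMSEQ_I)
    fix \<epsilon> :: real assume "\<epsilon> > 0"
    then obtain N where "\<forall>m\<ge>N. \<forall>n\<ge>N. L2_norm M (\<lambda>x. F m x - F n x) < \<epsilon>/2"
      using Cauchy[of "\<epsilon>/2"] by auto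
    then have "\<forall>n\<ge>N. L2_norm M (\<lambda>x. F n x - f x) \<le> \<epsilon>/2"
      using key[of "\<epsilon>/2" N] \<open>\<epsilon> > 0\<close> by simp
    then show "\<exists>N. \<forall>n\<ge>N. norm (L2_norm M (\<lambda>x. F n x - f x) - 0) < \<epsilon>"
      using \<open>\<epsilon> > 0\<close> by (intro exI[of _ N]) fastforce
  qed
  ultimately show ?thesis using F by (auto simp: L2_tendsto_def)
qed

section \<open>Orthogonal expansions: Pythagoras, Bessel, Parseval\<close>

lemma L2_norm_sum_orthogonal:
  assumes "finite I" "\<And>i. i \<in> I \<Longrightarrow> f i \<in> L2 M"
    and "\<And>i j. i \<in> I \<Longrightarrow> j \<in> I \<Longrightarrow> i \<noteq> j \<Longrightarrow> L2_inner M (f i) (f j) = 0"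
  shows "(L2_norm M (\<lambda>x. \<Sum>i\<in>I. f i x))\<^sup>2 = (\<Sum>i\<in>I. (L2_norm M (f i))\<^sup>2)"
  using assms
proof (induction I rule: finite_induct)
  case empty
  then show ?case by (simp add: L2_norm_def L2_inner_def)
next
  case (insert i I)
  have S: "(\<lambda>x. \<Sum>i\<in>I. f i x) \<in> L2 M" using insert.prems(1) by (intro L2_sum) auto
  have "L2_inner M (\<lambda>x. \<Sum>i\<in>I. f i x) (f i) = (\<Sum>j\<in>I. L2_inner M (f j) (f i))"
    using insert.prems(1) by (intro L2_inner_sum_left) auto
  also have "\<dots> = 0"
    using insert.prems(2) insert.hyps by (intro sum.neutral) auto
  finally have "L2_inner M (f i) (\<lambda>x. \<Sum>i\<in>I. f i x) = 0"
    by (simp add: L2_inner_commute)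
  then have "(L2_norm M (\<lambda>x. f i x + (\<Sum>i\<in>I. f i x)))\<^sup>2 =
      (L2_norm M (f i))\<^sup>2 + (L2_norm M (\<lambda>x. \<Sum>i\<in>I. f i x))\<^sup>2"
    using L2_norm_add_power2[OF _ S] insert.prems(1) by simp
  moreover have "(L2_norm M (\<lambda>x. \<Sum>i\<in>I. f i x))\<^sup>2 = (\<Sum>i\<in>I. (L2_norm M (f i))\<^sup>2)"
    using insert by auto
  ultimately show ?case using insert.hyps by simp
qed

text \<open>Completing the square in each \<open>c i\<close>. The Fourier coefficients make the last
  sum vanish, which gives both Bessel's inequality and the minimality of the Fourier sum.\<close>

lemma L2_best_approximation:
  assumes "finite I" "\<And>i. i \<in> I \<Longrightarrow> u i \<in> L2 M"
    and "\<And>i j. i \<in> I \<Longrightarrow> j \<in> I \<Longrightarrow> L2_inner M (u i) (u j) = (if i = j then 1 else 0)"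
    and f: "f \<in> L2 M"
  shows "(L2_norm M (\<lambda>x. f x - (\<Sum>i\<in>I. c i * u i x)))\<^sup>2 =
    (L2_norm M f)\<^sup>2 - (\<Sum>i\<in>I. (L2_inner M f (u i))\<^sup>2) + (\<Sum>i\<in>I. (c i - L2_inner M f (u i))\<^sup>2)"
proof -
  have "(L2_norm M (\<lambda>x. \<Sum>i\<in>I. c i * u i x))\<^sup>2 = (\<Sum>i\<in>I. (L2_norm M (\<lambda>x. c i * u i x))\<^sup>2)"
    using assms(1-3)
    by (intro L2_norm_sum_orthogonal L2_cmult)
      (auto simp: L2_inner_cmult_left L2_inner_cmult_right)
  also have "\<dots> = (\<Sum>i\<in>I. (c i)\<^sup>2)"
    unfolding L2_norm_power2 L2_inner_cmult_left L2_inner_cmult_right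
    using assms(3) by (intro sum.cong refl) (simp add: power2_eq_square)
  finally have 1: "(L2_norm M (\<lambda>x. \<Sum>i\<in>I. c i * u i x))\<^sup>2 = (\<Sum>i\<in>I. (c i)\<^sup>2)" .
  have "L2_inner M f (\<lambda>x. \<Sum>i\<in>I. c i * u i x) = (\<Sum>i\<in>I. L2_inner M (\<lambda>x. c i * u i x) f)"
    using assms(2) f by (subst L2_inner_commute, intro L2_inner_sum_left L2_cmult) auto
  then have 2: "L2_inner M f (\<lambda>x. \<Sum>i\<in>I. c i * u i x) = (\<Sum>i\<in>I. c i * L2_inner M f (u i))"
    by (simp add: L2_inner_cmult_left L2_inner_commute[of M f])
  have S: "(\<lambda>x. \<Sum>i\<in>I. c i * u i x) \<in> L2 M" using assms(2) by (intro L2_sum L2_cmult) auto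
  show ?thesis
    unfolding L2_norm_diff_power2[OF f S] 1 2
    by (simp add: power2_diff sum.distrib sum_subtractf sum_distrib_left algebra_simps)
qed

lemma L2_Bessel:
  assumes "finite I" "\<And>i. i \<in> I \<Longrightarrow> u i \<in> L2 M"
    and "\<And>i j. i \<in> I \<Longrightarrow> j \<in> I \<Longrightarrow> L2_inner M (u i) (u j) = (if i = j then 1 else 0)"
    and "f \<in> L2 M"
  shows "(\<Sum>i\<in>I. (L2_inner M f (u i))\<^sup>2) \<le> (L2_norm M f)\<^sup>2"
  using L2_best_approximation[OF assms, of "\<lambda>i. L2_inner M f (u i)"]
    zero_le_power2[of "L2_norm M (\<lambda>x. f x - (\<Sum>i\<in>I. L2_inner M f (u i) * u i x))"]
  by simp

text \<open>Partial Fourier sums are best approximations, so the density clause of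
  \<open>hilbert_basis\<close> forces them to converge to \<open>f\<close>; Cauchy-Schwarz then
  allows pairing with \<open>g\<close>.\<close>

lemma hilbert_basis_Parseval:
  assumes e: "hilbert_basis M e" and f: "f \<in> L2 M" and g: "g \<in> L2 M"
  shows "(\<lambda>N. \<Sum>j=1..N. L2_inner M f (e j) * L2_inner M g (e j)) \<longlonglongrightarrow> L2_inner M f g"
proof -
  have eL2: "e j \<in> L2 M" if "j \<ge> 1" for j
    using e that by (simp add: hilbert_basis_def)
  have on: "L2_inner M (e i) (e j) = (if i = j then 1 else 0)" if "i \<ge> 1" "j \<ge> 1" for i j
    using e that by (simp add: hilbert_basis_def)
  define P where "P N x = (\<Sum>j=1..N. L2_inner M f (e j) * e j x)" for N x
  have P: "P N \<in> L2 M" for N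
    unfolding P_def using eL2 by (intro L2_sum L2_cmult) auto
  have approx: "(\<lambda>N. L2_norm M (\<lambda>x. f x - P N x)) \<longlonglongrightarrow> 0"
  proof (rule LIMSEQ_I)
    fix \<epsilon> :: real assume "\<epsilon> > 0"
    then obtain N c where Nc: "L2_norm M (\<lambda>x. f x - (\<Sum>j=1..N. c j * e j x)) < \<epsilon>"
      using e f unfolding hilbert_basis_def by blast
    have "L2_norm M (\<lambda>x. f x - P n x) < \<epsilon>" if "n \<ge> N" for n
    proof -
      \<comment> \<open>Padding with zeros makes the given combination of \<open>N\<close> terms a
        competitor among combinations of \<open>n\<close> terms.\<close>
      define c' where "c' j = (if j \<le> N then c j else 0)" for j
      have "(\<Sum>j=1..n. c' j * e j x) = (\<Sum>j=1..N. c j * e j x)" for x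
        using that by (intro sum.mono_neutral_cong_right) (auto simp: c'_def)
      moreover have "(L2_norm M (\<lambda>x. f x - P n x))\<^sup>2 \<le> (L2_norm M (\<lambda>x. f x - (\<Sum>j=1..n. c' j * e j x)))\<^sup>2"
        unfolding P_def
        by (subst (1 2) L2_best_approximation) (use eL2 on f in \<open>auto intro!: sum_nonneg\<close>)
      ultimately have "L2_norm M (\<lambda>x. f x - P n x) \<le> L2_norm M (\<lambda>x. f x - (\<Sum>j=1..N. c j * e j x))"
        by (simp add: power2_le_iff_abs_le)
      then show ?thesis using Nc by simp
    qed
    then show "\<exists>N. \<forall>n\<ge>N. norm (L2_norm M (\<lambda>x. f x - P n x) - 0) < \<epsilon>" by auto
  qed
  have "L2_inner M (P N) g = (\<Sum>j=1..N. L2_inner M f (e j) * L2_inner M g (e j))" for N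
    unfolding P_def using eL2 g
    by (subst L2_inner_sum_left) (auto simp: L2_cmult L2_inner_cmult_left L2_inner_commute[of M g])
  then have eq: "(\<Sum>j=1..N. L2_inner M f (e j) * L2_inner M g (e j)) - L2_inner M f g =
      - L2_inner M (\<lambda>x. f x - P N x) g" for N
    using L2_inner_diff_left[OF f P g, of N] by simp
  have "(\<lambda>N. (\<Sum>j=1..N. L2_inner M f (e j) * L2_inner M g (e j)) - L2_inner M f g) \<longlonglongrightarrow> 0"
  proof (rule Lim_null_comparison)
    show "\<forall>\<^sub>F N in sequentially. norm ((\<Sum>j=1..N. L2_inner M f (e j) * L2_inner M g (e j)) - L2_inner M f g)
        \<le> L2_norm M (\<lambda>x. f x - P N x) * L2_norm M g"
      unfolding eq using L2_Cauchy_Schwarz[OF L2_diff[OF f P] g] by simp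
    show "(\<lambda>N. L2_norm M (\<lambda>x. f x - P N x) * L2_norm M g) \<longlonglongrightarrow> 0"
      using tendsto_mult_right[OF approx, of "L2_norm M g"] by simp
  qed
  then show ?thesis by (simp add: LIM_zero_iff)
qed

text \<open>By Pythagoras the squared distances between partial sums are increments of the bounded
  increasing sequence \<open>s\<close>, so the partial sums are Cauchy. The existence of a limit is
  what gives the choice in \<open>L2_series\<close> its meaning.\<close>

lemma (in prob_space) L2_series_orthogonal:
  assumes F: "\<And>j. j \<ge> m \<Longrightarrow> F j \<in> L2 M"
    and orth: "\<And>i j. m \<le> i \<Longrightarrow> i < j \<Longrightarrow> L2_inner M (F i) (F j) = 0"
    and bound: "\<And>N. (\<Sum>j=m..N. (L2_norm M (F j))\<^sup>2) \<le> B"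
  shows "L2_tendsto M (\<lambda>N x. \<Sum>j=m..N. F j x) (L2_series M m F)"
proof -
  have orth': "L2_inner M (F i) (F j) = 0" if "m \<le> i" "m \<le> j" "i \<noteq> j" for i j
    using orth[of i j] orth[of j i] that by (metis L2_inner_commute nat_neq_iff)
  define s where "s N = (\<Sum>j=m..N. (L2_norm M (F j))\<^sup>2)" for N
  have diff: "(L2_norm M (\<lambda>x. (\<Sum>j=m..p. F j x) - (\<Sum>j=m..q. F j x)))\<^sup>2 = s p - s q" if "q \<le> p" for p q
  proof -
    have difference: "(\<Sum>j=m..p. G j) - (\<Sum>j=m..q. G j) = (\<Sum>j\<in>{m..p} - {m..q}. G j)" for G :: "nat \<Rightarrow> real"
      using that by (subst sum_diff) auto
    show ?thesis
      unfolding difference s_def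
      by (rule L2_norm_sum_orthogonal) (use F orth' in auto)
  qed
  have "incseq s" unfolding s_def
    by (intro incseq_SucI sum_mono2) auto
  then have C: "Cauchy s"
    using incseq_convergent[of s B] bound unfolding s_def by (metis LIMSEQ_imp_Cauchy)
  have "\<exists>f. L2_tendsto M (\<lambda>N x. \<Sum>j=m..N. F j x) f"
  proof (rule L2_complete)
    show "(\<lambda>x. \<Sum>j=m..N. F j x) \<in> L2 M" for N using F by (intro L2_sum) auto
    fix \<epsilon> :: real assume \<epsilon>: "\<epsilon> > 0"
    then obtain N where N: "\<And>p q. p \<ge> N \<Longrightarrow> q \<ge> N \<Longrightarrow> \<bar>s p - s q\<bar> < \<epsilon>\<^sup>2"
      using metric_CauchyD[OF C, of "\<epsilon>\<^sup>2"] by (auto simp: dist_real_def)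
    have "L2_norm M (\<lambda>x. (\<Sum>j=m..p. F j x) - (\<Sum>j=m..q. F j x)) < \<epsilon>" if "N \<le> p" "N \<le> q" "q \<le> p" for p q
      using N[of p q] diff[of q p] that \<epsilon> by (intro power2_less_imp_less[of _ \<epsilon>]) auto
    note le = this
    have "L2_norm M (\<lambda>x. (\<Sum>j=m..p. F j x) - (\<Sum>j=m..q. F j x)) < \<epsilon>" if "N \<le> p" "N \<le> q" for p q
    proof (cases "q \<le> p")
      case False
      then have "L2_norm M (\<lambda>x. (\<Sum>j=m..q. F j x) - (\<Sum>j=m..p. F j x)) < \<epsilon>"
        using le that by simp
      then show ?thesis
        by (subst L2_norm_minus_commute)
    qed (use le that in blast)
    then show "\<exists>N. \<forall>p\<ge>N. \<forall>q\<ge>N. L2_norm M (\<lambda>x. (\<Sum>j=m..p. F j x) - (\<Sum>j=m..q. F j x)) < \<epsilon>"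
      by blast
  qed
  then show ?thesis
    unfolding L2_series_def by (rule someI_ex)
qed

text \<open>The error is split into \<open>(F n - f) * (G n - g)\<close>,
  \<open>(F n - f) * g\<close> and \<open>f * (G n - g)\<close>, so that the errors are multiplied
  only by each other or by the fixed norms of \<open>f\<close> and \<open>g\<close>.\<close>

lemma L2_tendsto_mult_L1:
  assumes "L2_tendsto M F f" "L2_tendsto M G g"
  shows "(\<lambda>n. \<integral>x. \<bar>F n x * G n x - f x * g x\<bar> \<partial>M) \<longlonglongrightarrow> 0"
proof -
  note F = L2_tendstoD[OF assms(1)] and G = L2_tendstoD[OF assms(2)]
  let ?a = "\<lambda>n. L2_norm M (\<lambda>x. F n x - f x)" and ?b = "\<lambda>n. L2_norm M (\<lambda>x. G n x - g x)"
  have "(\<integral>x. \<bar>F n x * G n x - f x * g x\<bar> \<partial>M) \<le> ?a n * ?b n + ?a n * L2_norm M g + L2_norm M f * ?b n" for n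
  proof -
    let ?A = "\<lambda>x. (F n x - f x) * (G n x - g x)" and ?B = "\<lambda>x. (F n x - f x) * g x"
      and ?C = "\<lambda>x. f x * (G n x - g x)"
    have int: "integrable M ?A" "integrable M ?B" "integrable M ?C"
      using F G by (auto intro!: L2_mult_integrable L2_diff)
    have "(\<integral>x. \<bar>F n x * G n x - f x * g x\<bar> \<partial>M) = (\<integral>x. \<bar>?A x + ?B x + ?C x\<bar> \<partial>M)"
      by (intro Bochner_Integration.integral_cong refl arg_cong[of _ _ abs]) (simp add: algebra_simps)
    also have "\<dots> \<le> (\<integral>x. \<bar>?A x\<bar> + \<bar>?B x\<bar> + \<bar>?C x\<bar> \<partial>M)"
      using int by (intro integral_mono integrable_abs Bochner_Integration.integrable_add) auto
    also have "\<dots> = (\<integral>x. \<bar>?A x\<bar> \<partial>M) + (\<integral>x. \<bar>?B x\<bar> \<partial>M) + (\<integral>x. \<bar>?C x\<bar> \<partial>M)"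
      using int by simp
    also have "\<dots> \<le> ?a n * ?b n + ?a n * L2_norm M g + L2_norm M f * ?b n"
      using F G by (intro add_mono L2_abs_mult_le L2_diff) auto
    finally show ?thesis .
  qed
  moreover have "(\<lambda>n. ?a n * ?b n + ?a n * L2_norm M g + L2_norm M f * ?b n) \<longlonglongrightarrow>
      0 * 0 + 0 * L2_norm M g + L2_norm M f * 0"
    by (intro tendsto_intros F G)
  ultimately show ?thesis
    by (intro LIMSEQ_zero_bounded[of "\<lambda>n. \<integral>x. \<bar>F n x * G n x - f x * g x\<bar> \<partial>M"]) auto
qed

subsection \<open>Orthogonal chaos series\<close>

text \<open>The fourth moment puts the square of \<open>X k\<close> into L2, and its uniform bound
  \<open>K\<close> controls the diagonal series; independence, centring and unit variance make the
  \<open>X k\<close> orthonormal.\<close>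

locale noise = prob_space M for M :: "'e measure" +
  fixes X :: "nat \<Rightarrow> 'e \<Rightarrow> real" and K :: real
  assumes indep: "indep_vars (\<lambda>_. borel) X {1..}"
    and mean_zero: "k \<ge> 1 \<Longrightarrow> expectation (X k) = 0"
    and second_moment: "k \<ge> 1 \<Longrightarrow> expectation (\<lambda>\<omega>. (X k \<omega>)\<^sup>2) = 1"
    and fourth_integrable: "k \<ge> 1 \<Longrightarrow> integrable M (\<lambda>\<omega>. X k \<omega> ^ 4)"
    and fourth_moment: "k \<ge> 1 \<Longrightarrow> expectation (\<lambda>\<omega>. X k \<omega> ^ 4) \<le> K"
begin

lemma X_measurable: "k \<ge> 1 \<Longrightarrow> X k \<in> borel_measurable M"
  using indep by (auto simp: indep_vars_def)

lemma X_square_L2: "k \<ge> 1 \<Longrightarrow> (\<lambda>\<omega>. (X k \<omega>)\<^sup>2) \<in> L2 M"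
  using fourth_integrable[of k] X_measurable[of k] by (intro L2_I) auto

lemma X_L2: "k \<ge> 1 \<Longrightarrow> X k \<in> L2 M"
  using L2_integrable[OF X_square_L2] X_measurable by (intro L2_I) auto

lemma X_norm: "k \<ge> 1 \<Longrightarrow> L2_norm M (X k) = 1"
  using second_moment[of k] by (simp add: L2_norm_def L2_inner_def power2_eq_square)

text \<open>Independence is first obtained for the restricted families, as random elements of
  product spaces, and then carried over by composing with \<open>\<phi>\<close> and with the
  projection to \<open>j\<close>. For \<open>j = 1\<close> the past is empty and \<open>Y\<close> is
  constant.\<close>

lemma indep_past:
  assumes "j \<ge> 1" "\<phi> \<in> borel_measurable (PiM {1..<j} (\<lambda>_. borel))"
    and "\<And>\<omega>. Y \<omega> = \<phi> (\<lambda>i\<in>{1..<j}. X i \<omega>)"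
  shows "indep_var borel Y borel (X j)"
proof -
  have "indep_var (PiM {1..<j} (\<lambda>_. borel)) (\<lambda>\<omega>. \<lambda>i\<in>{1..<j}. X i \<omega>)
      (PiM {j} (\<lambda>_. borel)) (\<lambda>\<omega>. \<lambda>i\<in>{j}. X i \<omega>)"
    using assms(1) by (intro indep_var_restrict[OF indep]) auto
  then have "indep_var borel (\<phi> \<circ> (\<lambda>\<omega>. \<lambda>i\<in>{1..<j}. X i \<omega>)) borel ((\<lambda>x. x j) \<circ> (\<lambda>\<omega>. \<lambda>i\<in>{j}. X i \<omega>))"
    by (rule indep_var_compose) (use assms(2) in \<open>auto intro: measurable_component_singleton\<close>)
  moreover have "\<phi> \<circ> (\<lambda>\<omega>. \<lambda>i\<in>{1..<j}. X i \<omega>) = Y" "(\<lambda>x. x j) \<circ> (\<lambda>\<omega>. \<lambda>i\<in>{j}. X i \<omega>) = X j"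
    using assms(3) by (auto simp: fun_eq_iff)
  ultimately show ?thesis by simp
qed

lemma indep_pair:
  assumes "1 \<le> i" "i < j"
  shows "indep_var borel (X i) borel (X j)"
  using assms by (intro indep_past[where \<phi>="\<lambda>x. x i"]) auto

lemma expectation_mult_X:
  assumes "indep_var borel Y borel (X j)" "j \<ge> 1" "integrable M Y"
  shows "expectation (\<lambda>\<omega>. Y \<omega> * X j \<omega>) = 0"
  using indep_var_lebesgue_integral[OF assms(1,3) L2_integrable[OF X_L2[OF assms(2)]]]
    mean_zero[OF assms(2)] by simp

text \<open>The squares of \<open>Y\<close> and \<open>X j\<close> are again independent, so the
  second moment of the product factors, and that of \<open>X j\<close> is 1.\<close>

lemma L2_mult_X:
  assumes ind: "indep_var borel Y borel (X j)" and j: "j \<ge> 1" and Y: "Y \<in> L2 M"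
  shows "(\<lambda>\<omega>. Y \<omega> * X j \<omega>) \<in> L2 M" "L2_norm M (\<lambda>\<omega>. Y \<omega> * X j \<omega>) = L2_norm M Y"
proof -
  have "indep_var borel ((\<lambda>x. x\<^sup>2) \<circ> Y) borel ((\<lambda>x. x\<^sup>2) \<circ> X j)"
    by (rule indep_var_compose[OF ind]) auto
  then have ind2: "indep_var borel (\<lambda>\<omega>. (Y \<omega>)\<^sup>2) borel (\<lambda>\<omega>. (X j \<omega>)\<^sup>2)"
    by (simp add: comp_def)
  note int = L2_square_integrable[OF Y] L2_square_integrable[OF X_L2[OF j]]
  show "(\<lambda>\<omega>. Y \<omega> * X j \<omega>) \<in> L2 M"
    using L2_measurable[OF Y] X_measurable[OF j] indep_var_integrable[OF ind2 int]
    by (intro L2_I) (auto simp: power_mult_distrib)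
  have "L2_inner M (\<lambda>\<omega>. Y \<omega> * X j \<omega>) (\<lambda>\<omega>. Y \<omega> * X j \<omega>) = expectation (\<lambda>\<omega>. (Y \<omega>)\<^sup>2 * (X j \<omega>)\<^sup>2)"
    by (simp add: L2_inner_def power2_eq_square ac_simps)
  also have "\<dots> = L2_inner M Y Y"
    unfolding indep_var_lebesgue_integral[OF ind2 int]
    using second_moment[OF j] by (simp add: L2_inner_def power2_eq_square)
  finally show "L2_norm M (\<lambda>\<omega>. Y \<omega> * X j \<omega>) = L2_norm M Y"
    by (simp add: L2_norm_def)
qed

lemma X_orthogonal:
  assumes "1 \<le> i" "1 \<le> j" "i \<noteq> j"
  shows "L2_inner M (X i) (X j) = 0"
proof -
  have *: "L2_inner M (X i) (X j) = 0" if "1 \<le> i" "i < j" for i j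
    unfolding L2_inner_def
    using that by (intro expectation_mult_X indep_pair L2_integrable X_L2) auto
  show ?thesis
  proof (cases "i < j")
    case False
    then show ?thesis
      using *[of j i] assms by (subst L2_inner_commute) auto
  qed (use * assms in auto)
qed

lemma linear_chaos_norm:
  assumes "finite I" "\<And>k. k \<in> I \<Longrightarrow> k \<ge> 1"
  shows "(L2_norm M (\<lambda>\<omega>. \<Sum>k\<in>I. a k * X k \<omega>))\<^sup>2 = (\<Sum>k\<in>I. (a k)\<^sup>2)"
proof -
  have "(L2_norm M (\<lambda>\<omega>. \<Sum>k\<in>I. a k * X k \<omega>))\<^sup>2 = (\<Sum>k\<in>I. (L2_norm M (\<lambda>\<omega>. a k * X k \<omega>))\<^sup>2)"
    using assms
    by (intro L2_norm_sum_orthogonal L2_cmult X_L2)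
      (auto simp: L2_inner_cmult_left L2_inner_cmult_right X_orthogonal)
  also have "\<dots> = (\<Sum>k\<in>I. (a k)\<^sup>2)"
    using assms(2) unfolding L2_norm_power2 L2_inner_cmult_left L2_inner_cmult_right
    by (intro sum.cong refl) (simp add: L2_norm_power2[symmetric] X_norm power2_eq_square)
  finally show ?thesis .
qed

lemma linear_chaos_L2: "(\<And>k. k \<in> I \<Longrightarrow> k \<ge> 1) \<Longrightarrow> (\<lambda>\<omega>. \<Sum>k\<in>I. a k * X k \<omega>) \<in> L2 M"
  by (intro L2_sum L2_cmult X_L2)

lemma linear_chaos_series:
  assumes "\<And>N. (\<Sum>k=1..N. (a k)\<^sup>2) \<le> B"
  shows "L2_tendsto M (\<lambda>N \<omega>. \<Sum>k=1..N. a k * X k \<omega>) (L2_series M 1 (\<lambda>k \<omega>. a k * X k \<omega>))"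
proof (rule L2_series_orthogonal)
  have "L2_norm M (\<lambda>\<omega>. a k * X k \<omega>) ^ 2 = (a k)\<^sup>2" if "k \<ge> 1" for k
    using linear_chaos_norm[of "{k}" a] that by simp
  then show "(\<Sum>j=1..N. (L2_norm M (\<lambda>\<omega>. a j * X j \<omega>))\<^sup>2) \<le> B" for N
    using assms[of N] by simp
qed (auto intro!: L2_cmult X_L2 simp: L2_inner_cmult_left L2_inner_cmult_right X_orthogonal)

text \<open>
  The factor multiplying \<open>X j\<close> depends only on \<open>X k\<close> with \<open>k < j\<close>, so these terms are
  martingale differences; this is what makes them orthogonal.
\<close>

definition "offdiag c j \<omega> = (\<Sum>k=1..j-1. c k * X k \<omega>) * X j \<omega>"

text \<open>Exhibits the sum as a function of the restricted family, the shape that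
  \<open>indep_past\<close> asks for.\<close>

lemma sum_past: "(\<Sum>k=1..j-1. c k * X k \<omega>) = (\<Sum>k=1..<j. c k * (\<lambda>i\<in>{1..<j}. X i \<omega>) k)"
  by (intro sum.cong) auto

lemma offdiag_L2:
  assumes "j \<ge> 1"
  shows "offdiag c j \<in> L2 M" "(L2_norm M (offdiag c j))\<^sup>2 = (\<Sum>k=1..j-1. (c k)\<^sup>2)"
proof -
  have "indep_var borel (\<lambda>\<omega>. \<Sum>k=1..j-1. c k * X k \<omega>) borel (X j)"
    using assms by (rule indep_past[where \<phi>="\<lambda>x. \<Sum>k=1..<j. c k * x k"]) (measurable, rule sum_past)
  note L2_mult_X[OF this assms linear_chaos_L2]
  then show "offdiag c j \<in> L2 M" "(L2_norm M (offdiag c j))\<^sup>2 = (\<Sum>k=1..j-1. (c k)\<^sup>2)"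
    unfolding offdiag_def using linear_chaos_norm[of "{1..j-1}" c] by auto
qed

text \<open>Since \<open>i < j\<close>, the product of \<open>offdiag c i\<close> with the factor in
  front of \<open>X j\<close> is still a function of the variables before \<open>j\<close>, and it
  is integrable as a product of two L2 functions. The centred independent \<open>X j\<close> then
  makes the expectation vanish.\<close>

lemma offdiag_orthogonal:
  assumes "1 \<le> i" "i < j"
  shows "L2_inner M (offdiag c i) (offdiag d j) = 0"
proof -
  let ?Y = "\<lambda>\<omega>. offdiag c i \<omega> * (\<Sum>k=1..j-1. d k * X k \<omega>)"
  have "indep_var borel ?Y borel (X j)"
  proof (rule indep_past)
    show "(\<lambda>x. (\<Sum>k=1..<i. c k * x k) * x i * (\<Sum>k=1..<j. d k * x k)) \<in> borel_measurable (Pi\<^sub>M {1..<j} (\<lambda>_. borel))"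
      using assms by (intro borel_measurable_times borel_measurable_sum borel_measurable_const measurable_component_singleton) auto
    have "(\<Sum>k=1..i-1. c k * X k \<omega>) = (\<Sum>k=1..<i. c k * (\<lambda>i\<in>{1..<j}. X i \<omega>) k)" for \<omega>
      using assms by (intro sum.cong) auto
    then show "?Y \<omega> = (\<Sum>k=1..<i. c k * (\<lambda>i\<in>{1..<j}. X i \<omega>) k) * (\<lambda>i\<in>{1..<j}. X i \<omega>) i
        * (\<Sum>k=1..<j. d k * (\<lambda>i\<in>{1..<j}. X i \<omega>) k)" for \<omega>
      unfolding offdiag_def sum_past[of d] using assms by simp
  qed (use assms in auto)
  then have "expectation (\<lambda>\<omega>. ?Y \<omega> * X j \<omega>) = 0"
    using assms by (intro expectation_mult_X L2_mult_integrable offdiag_L2 linear_chaos_L2) auto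
  then show ?thesis
    unfolding L2_inner_def by (simp add: offdiag_def[of d] mult.assoc)
qed

lemma offdiag_partial_norm:
  "(L2_norm M (\<lambda>\<omega>. \<Sum>j=2..N. offdiag (c j) j \<omega>))\<^sup>2 = (\<Sum>j=2..N. \<Sum>k=1..j-1. (c j k)\<^sup>2)"
proof -
  have "L2_inner M (offdiag (c i) i) (offdiag (c j) j) = 0" if "i \<noteq> j" "2 \<le> i" "2 \<le> j" for i j
    using offdiag_orthogonal[of i j "c i" "c j"] offdiag_orthogonal[of j i "c j" "c i"] that
    by (cases "i < j") (auto simp: L2_inner_commute[of M "offdiag (c i) i"])
  then show ?thesis
    by (subst L2_norm_sum_orthogonal) (auto simp: offdiag_L2)
qed

lemma offdiag_series:
  assumes "\<And>N. (\<Sum>j=2..N. \<Sum>k=1..j-1. (c j k)\<^sup>2) \<le> B"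
  shows "L2_tendsto M (\<lambda>N \<omega>. \<Sum>j=2..N. offdiag (c j) j \<omega>) (L2_series M 2 (\<lambda>j. offdiag (c j) j))"
  by (rule L2_series_orthogonal[where B=B])
    (use assms in \<open>auto simp: offdiag_L2 offdiag_orthogonal\<close>)

text \<open>Unit variance centres the squares, and expanding shows that the squared norm is the
  fourth moment minus 1; this is the origin of the constant \<open>K\<close> in the diagonal
  bounds.\<close>

lemma diag_L2:
  assumes k: "k \<ge> 1"
  shows "(\<lambda>\<omega>. (X k \<omega>)\<^sup>2 - 1) \<in> L2 M" "(L2_norm M (\<lambda>\<omega>. (X k \<omega>)\<^sup>2 - 1))\<^sup>2 \<le> K"
    "expectation (\<lambda>\<omega>. (X k \<omega>)\<^sup>2 - 1) = 0"
proof -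
  show "(\<lambda>\<omega>. (X k \<omega>)\<^sup>2 - 1) \<in> L2 M"
    using k by (intro L2_diff X_square_L2 L2_const)
  have int: "integrable M (\<lambda>\<omega>. (X k \<omega>)\<^sup>2)" using k by (intro L2_integrable X_square_L2)
  then show "expectation (\<lambda>\<omega>. (X k \<omega>)\<^sup>2 - 1) = 0"
    using second_moment[OF k] by (simp add: prob_space)
  have "L2_inner M (\<lambda>\<omega>. (X k \<omega>)\<^sup>2 - 1) (\<lambda>\<omega>. (X k \<omega>)\<^sup>2 - 1) =
      expectation (\<lambda>\<omega>. X k \<omega> ^ 4 - 2 * (X k \<omega>)\<^sup>2 + 1)"
    unfolding L2_inner_def
    by (intro Bochner_Integration.integral_cong refl) (simp add: algebra_simps power2_eq_square power4_eq_xxxx)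
  also have "\<dots> = expectation (\<lambda>\<omega>. X k \<omega> ^ 4) - 1"
    using int fourth_integrable[OF k] second_moment[OF k] by (simp add: prob_space)
  finally show "(L2_norm M (\<lambda>\<omega>. (X k \<omega>)\<^sup>2 - 1))\<^sup>2 \<le> K"
    unfolding L2_norm_power2 using fourth_moment[OF k] by simp
qed

lemma diag_orthogonal:
  assumes "1 \<le> i" "1 \<le> j" "i \<noteq> j"
  shows "L2_inner M (\<lambda>\<omega>. (X i \<omega>)\<^sup>2 - 1) (\<lambda>\<omega>. (X j \<omega>)\<^sup>2 - 1) = 0"
proof -
  have *: "L2_inner M (\<lambda>\<omega>. (X i \<omega>)\<^sup>2 - 1) (\<lambda>\<omega>. (X j \<omega>)\<^sup>2 - 1) = 0" if "1 \<le> i" "i < j" for i j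
  proof -
    have "indep_var borel ((\<lambda>x. x\<^sup>2 - 1) \<circ> X i) borel ((\<lambda>x. x\<^sup>2 - 1) \<circ> X j)"
      by (rule indep_var_compose[OF indep_pair[OF that]]) auto
    then have "indep_var borel (\<lambda>\<omega>. (X i \<omega>)\<^sup>2 - 1) borel (\<lambda>\<omega>. (X j \<omega>)\<^sup>2 - 1)"
      by (simp add: comp_def)
    from indep_var_lebesgue_integral[OF this] show ?thesis
      using that diag_L2[of i] diag_L2[of j] L2_integrable[OF diag_L2(1)]
      unfolding L2_inner_def by simp
  qed
  show ?thesis
  proof (cases "i < j")
    case False
    then show ?thesis
      using *[of j i] assms by (subst L2_inner_commute) auto
  qed (use * assms in auto)
qed

lemma diag_norm: "k \<ge> 1 \<Longrightarrow> (L2_norm M (\<lambda>\<omega>. a * ((X k \<omega>)\<^sup>2 - 1)))\<^sup>2 \<le> K * a\<^sup>2"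
  using mult_right_mono[OF diag_L2(2)[of k], of "a\<^sup>2"]
  unfolding L2_norm_power2 L2_inner_cmult_left L2_inner_cmult_right
  by (simp add: power2_eq_square[of a] ac_simps)

text \<open>Only an inequality, unlike its linear and off-diagonal counterparts: the terms are
  orthogonal, but their norms vary with the fourth moments.\<close>

lemma diag_partial_norm:
  "(L2_norm M (\<lambda>\<omega>. \<Sum>k=1..N. a k * ((X k \<omega>)\<^sup>2 - 1)))\<^sup>2 \<le> K * (\<Sum>k=1..N. (a k)\<^sup>2)"
  by (subst L2_norm_sum_orthogonal)
    (auto simp: L2_inner_cmult_left L2_inner_cmult_right diag_orthogonal sum_distrib_left
      intro!: L2_cmult diag_L2 sum_mono diag_norm)

lemma K_nonneg: "0 \<le> K"
  using order_trans[OF zero_le_power2 diag_L2(2)[of 1]] by simp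

lemma diag_series:
  assumes "\<And>N. (\<Sum>k=1..N. (a k)\<^sup>2) \<le> B"
  shows "L2_tendsto M (\<lambda>N \<omega>. \<Sum>k=1..N. a k * ((X k \<omega>)\<^sup>2 - 1))
    (L2_series M 1 (\<lambda>k \<omega>. a k * ((X k \<omega>)\<^sup>2 - 1)))"
proof (rule L2_series_orthogonal[where B="K * B"])
  fix N
  have "(\<Sum>k=1..N. (L2_norm M (\<lambda>\<omega>. a k * ((X k \<omega>)\<^sup>2 - 1)))\<^sup>2) \<le> (\<Sum>k=1..N. K * (a k)\<^sup>2)"
    by (intro sum_mono diag_norm) auto
  also have "\<dots> \<le> K * B"
    using assms[of N] K_nonneg by (simp add: sum_distrib_left[symmetric] mult_left_mono)
  finally show "(\<Sum>k=1..N. (L2_norm M (\<lambda>\<omega>. a k * ((X k \<omega>)\<^sup>2 - 1)))\<^sup>2) \<le> K * B" .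
qed (auto simp: L2_inner_cmult_left L2_inner_cmult_right diag_orthogonal intro!: L2_cmult diag_L2)

end

text \<open>The double sum splits into two triangles, folded together onto \<open>k < j\<close>, and
  the diagonal, where centring the squares leaves the sum of the \<open>a j * b j\<close>. The
  induction adds one row and one column.\<close>

lemma linear_chaos_product:
  fixes a b x :: "nat \<Rightarrow> real"
  shows "(\<Sum>k=1..N. a k * x k) * (\<Sum>k=1..N. b k * x k) =
    (\<Sum>j=2..N. (\<Sum>k=1..j-1. (a j * b k + b j * a k) * x k) * x j) +
    (\<Sum>j=1..N. a j * b j * ((x j)\<^sup>2 - 1)) + (\<Sum>j=1..N. a j * b j)"
proof (induction N)
  case 0
  then show ?case by simp
next
  case (Suc N)
  let ?A = "\<Sum>k=1..N. a k * x k" and ?B = "\<Sum>k=1..N. b k * x k" and ?n = "Suc N"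
  \<comment> \<open>For \<open>N = 0\<close> the outer sum gains no index, but then the inner sum of
    the extra term is empty too.\<close>
  have "(\<Sum>j=2..Suc N. (\<Sum>k=1..j-1. (a j * b k + b j * a k) * x k) * x j) =
      (\<Sum>j=2..N. (\<Sum>k=1..j-1. (a j * b k + b j * a k) * x k) * x j) +
      (\<Sum>k=1..N. (a ?n * b k + b ?n * a k) * x k) * x ?n"
    by (cases "N = 0") auto
  also have "(\<Sum>k=1..N. (a ?n * b k + b ?n * a k) * x k) = a ?n * ?B + b ?n * ?A"
    by (simp add: sum_distrib_left sum.distrib algebra_simps)
  finally show ?case
    using Suc.IH by (simp add: algebra_simps power2_eq_square)
qed

subsection \<open>Continuity in the kernel and the product formula\<close>

context pair_sigma_finite
begin

lemma tensor_integral: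
  assumes a: "integrable M1 a" and b: "integrable M2 b"
  shows "integrable (M1 \<Otimes>\<^sub>M M2) (tensor a b)"
    and "integral\<^sup>L (M1 \<Otimes>\<^sub>M M2) (tensor a b) = integral\<^sup>L M1 a * integral\<^sup>L M2 b"
proof -
  have [measurable]: "a \<in> borel_measurable M1" "b \<in> borel_measurable M2"
    using a b by auto
  show int: "integrable (M1 \<Otimes>\<^sub>M M2) (tensor a b)"
  proof (rule Fubini_integrable)
    show "tensor a b \<in> borel_measurable (M1 \<Otimes>\<^sub>M M2)"
      unfolding tensor_def by measurable
    show "integrable M1 (\<lambda>x. LINT y|M2. norm (tensor a b (x, y)))"
      using a b by (auto simp: tensor_def abs_mult)
    show "AE x in M1. integrable M2 (\<lambda>y. tensor a b (x, y))"
      using b by (auto simp: tensor_def)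
  qed
  show "integral\<^sup>L (M1 \<Otimes>\<^sub>M M2) (tensor a b) = integral\<^sup>L M1 a * integral\<^sup>L M2 b"
    using integral_fst'[OF int] by (simp add: tensor_def)
qed

lemma tensor_L2:
  assumes "h \<in> L2 M1" "g \<in> L2 M2"
  shows "tensor h g \<in> L2 (M1 \<Otimes>\<^sub>M M2)"
proof (rule L2_I)
  have [measurable]: "h \<in> borel_measurable M1" "g \<in> borel_measurable M2"
    using assms by (auto dest: L2_measurable)
  show "tensor h g \<in> borel_measurable (M1 \<Otimes>\<^sub>M M2)"
    unfolding tensor_def by measurable
  have "(\<lambda>z. (tensor h g z)\<^sup>2) = tensor (\<lambda>x. (h x)\<^sup>2) (\<lambda>y. (g y)\<^sup>2)"
    by (auto simp: tensor_def power_mult_distrib)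
  then show "integrable (M1 \<Otimes>\<^sub>M M2) (\<lambda>z. (tensor h g z)\<^sup>2)"
    using tensor_integral(1)[OF assms[THEN L2_square_integrable]] by simp
qed

lemma tensor_inner:
  assumes "h \<in> L2 M1" "u \<in> L2 M1" "g \<in> L2 M2" "v \<in> L2 M2"
  shows "L2_inner (M1 \<Otimes>\<^sub>M M2) (tensor h g) (tensor u v) = L2_inner M1 h u * L2_inner M2 g v"
proof -
  have "(\<lambda>z. tensor h g z * tensor u v z) = tensor (\<lambda>x. h x * u x) (\<lambda>y. g y * v y)"
    by (auto simp: tensor_def ac_simps)
  then show ?thesis
    using tensor_integral(2)[OF L2_mult_integrable[OF assms(1,2)] L2_mult_integrable[OF assms(3,4)]]
    by (simp add: L2_inner_def)
qed

end

text \<open>The product of \<open>\<mu>\<close> with itself is invariant under exchange of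
  coordinates. Convergence thus passes to mirror images, and the limit of the kernels has to be
  computed only on the side of \<open>C_upper\<close>.\<close>

lemma L2_tendsto_swap:
  assumes "sigma_finite_measure \<mu>" "L2_tendsto (\<mu> \<Otimes>\<^sub>M \<mu>) F f"
  shows "L2_tendsto (\<mu> \<Otimes>\<^sub>M \<mu>) (\<lambda>n z. F n (prod.swap z)) (\<lambda>z. f (prod.swap z))"
proof -
  interpret sigma_finite_measure \<mu> by fact
  interpret P: pair_sigma_finite \<mu> \<mu> by unfold_locales
  note F = L2_tendstoD[OF assms(2)]
  have L2: "(\<lambda>z. u (prod.swap z)) \<in> L2 (\<mu> \<Otimes>\<^sub>M \<mu>)" if "u \<in> L2 (\<mu> \<Otimes>\<^sub>M \<mu>)" for u
    using P.integrable_product_swap[OF L2_square_integrable[OF that]] L2_measurable[OF that]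
    by (intro L2_I) (auto simp: prod.swap_def case_prod_beta')
  have "L2_norm (\<mu> \<Otimes>\<^sub>M \<mu>) (\<lambda>z. u (prod.swap z)) = L2_norm (\<mu> \<Otimes>\<^sub>M \<mu>) u" if "u \<in> L2 (\<mu> \<Otimes>\<^sub>M \<mu>)" for u
    using P.integral_product_swap[of "\<lambda>z. u z * u z"] L2_measurable[OF that]
    by (simp add: L2_norm_def L2_inner_def prod.swap_def case_prod_beta')
  from this[OF L2_diff[OF F(1,2)]] show ?thesis
    using F L2 by (simp add: L2_tendsto_def)
qed

locale chaos = noise M X K for M :: "'e measure" and X K +
  fixes \<mu> :: "'a measure" and e :: "nat \<Rightarrow> 'a \<Rightarrow> real"
  assumes prob_mu: "prob_space \<mu>" and basis: "hilbert_basis \<mu> e"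
begin

sublocale E: prob_space \<mu> by (rule prob_mu)

sublocale EE: pair_prob_space \<mu> \<mu> by unfold_locales

lemma e_L2: "j \<ge> 1 \<Longrightarrow> e j \<in> L2 \<mu>"
  using basis by (simp add: hilbert_basis_def)

lemma e_inner: "1 \<le> j \<Longrightarrow> 1 \<le> k \<Longrightarrow> L2_inner \<mu> (e j) (e k) = (if j = k then 1 else 0)"
  using basis by (simp add: hilbert_basis_def)

definition "coef f j k = L2_inner (\<mu> \<Otimes>\<^sub>M \<mu>) f (tensor (e j) (e k))"

lemma ee_L2: "1 \<le> j \<Longrightarrow> 1 \<le> k \<Longrightarrow> tensor (e j) (e k) \<in> L2 (\<mu> \<Otimes>\<^sub>M \<mu>)"
  by (intro EE.tensor_L2 e_L2)

lemma coef_diff: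
  assumes "f \<in> L2 (\<mu> \<Otimes>\<^sub>M \<mu>)" "g \<in> L2 (\<mu> \<Otimes>\<^sub>M \<mu>)" "1 \<le> j" "1 \<le> k"
  shows "coef (\<lambda>z. f z - g z) j k = coef f j k - coef g j k"
  unfolding coef_def using assms by (intro L2_inner_diff_left ee_L2)

lemma coef_tensor:
  assumes "h \<in> L2 \<mu>" "g \<in> L2 \<mu>" "1 \<le> j" "1 \<le> k"
  shows "coef (tensor h g) j k = L2_inner \<mu> h (e j) * L2_inner \<mu> g (e k)"
  unfolding coef_def using assms by (intro EE.tensor_inner e_L2)

text \<open>By Fubini the tensors of basis vectors are orthonormal, so Bessel's inequality applies
  to the triangle, taken as one finite set of pairs.\<close>

lemma offdiag_Bessel:
  assumes "f \<in> L2 (\<mu> \<Otimes>\<^sub>M \<mu>)"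
  shows "(\<Sum>j=2..N. \<Sum>k=1..j-1. (coef f j k)\<^sup>2) \<le> (L2_norm (\<mu> \<Otimes>\<^sub>M \<mu>) f)\<^sup>2"
proof -
  have "(\<Sum>p\<in>(SIGMA j:{2..N}. {1..j-1}). (L2_inner (\<mu> \<Otimes>\<^sub>M \<mu>) f (tensor (e (fst p)) (e (snd p))))\<^sup>2)
      \<le> (L2_norm (\<mu> \<Otimes>\<^sub>M \<mu>) f)\<^sup>2"
    by (intro L2_Bessel assms) (auto simp: ee_L2 EE.tensor_inner e_L2 e_inner prod_eq_iff)
  then show ?thesis
    by (simp add: coef_def sum.Sigma case_prod_beta')
qed

lemma diag_Bessel:
  assumes "f \<in> L2 (\<mu> \<Otimes>\<^sub>M \<mu>)"
  shows "(\<Sum>j=1..N. (coef f j j)\<^sup>2) \<le> (L2_norm (\<mu> \<Otimes>\<^sub>M \<mu>) f)\<^sup>2"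
  unfolding coef_def
  by (intro L2_Bessel assms) (auto simp: ee_L2 EE.tensor_inner e_L2 e_inner)

text \<open>Together with \<open>phi11_tendsto\<close> and \<open>phi2_tendsto\<close> this replaces
  chosen representatives by limits of explicit partial sums; later arguments rely on these limits
  alone.\<close>

lemma Phi_tendsto:
  assumes "h \<in> L2 \<mu>"
  shows "L2_tendsto M (\<lambda>N \<omega>. \<Sum>k=1..N. L2_inner \<mu> h (e k) * X k \<omega>) (Phi M X \<mu> e h)"
  unfolding Phi_def
  by (intro linear_chaos_series[where B="(L2_norm \<mu> h)\<^sup>2"] L2_Bessel assms) (auto simp: e_L2 e_inner)

lemma phi11_tendsto:
  assumes "f \<in> L2 (\<mu> \<Otimes>\<^sub>M \<mu>)"
  shows "L2_tendsto M (\<lambda>N \<omega>. \<Sum>j=2..N. offdiag (coef f j) j \<omega>) (phi11 M X \<mu> e f)"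
proof -
  have "phi11 M X \<mu> e f = L2_series M 2 (\<lambda>j. offdiag (coef f j) j)"
    by (simp add: phi11_def offdiag_def[abs_def] coef_def)
  then show ?thesis
    using offdiag_series[OF offdiag_Bessel[OF assms]] by simp
qed

lemma phi2_tendsto:
  assumes "f \<in> L2 (\<mu> \<Otimes>\<^sub>M \<mu>)"
  shows "L2_tendsto M (\<lambda>N \<omega>. \<Sum>j=1..N. coef f j j * ((X j \<omega>)\<^sup>2 - 1)) (phi2 M X \<mu> e f)"
  using diag_series[OF diag_Bessel[OF assms]] by (simp add: phi2_def coef_def)

text \<open>The limits are representatives chosen separately for \<open>f\<close> and
  \<open>g\<close>, so subtraction is carried out on partial sums; Bessel's bound for
  \<open>f - g\<close> then passes to the limit.\<close>

lemma phi11_diff_norm: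
  assumes f: "f \<in> L2 (\<mu> \<Otimes>\<^sub>M \<mu>)" and g: "g \<in> L2 (\<mu> \<Otimes>\<^sub>M \<mu>)"
  shows "L2_norm M (\<lambda>\<omega>. phi11 M X \<mu> e f \<omega> - phi11 M X \<mu> e g \<omega>)
    \<le> L2_norm (\<mu> \<Otimes>\<^sub>M \<mu>) (\<lambda>z. f z - g z)"
proof (rule L2_tendsto_norm_bounded[OF L2_tendsto_diff[OF phi11_tendsto phi11_tendsto, OF f g]])
  fix N
  let ?d = "\<lambda>z. f z - g z"
  have "offdiag (coef f j) j \<omega> - offdiag (coef g j) j \<omega> = offdiag (coef ?d j) j \<omega>" if "j \<ge> 1" for j \<omega>
    using that by (simp add: offdiag_def coef_diff[OF f g] sum_subtractf algebra_simps)
  then have eq: "(\<Sum>j=2..N. offdiag (coef f j) j \<omega>) - (\<Sum>j=2..N. offdiag (coef g j) j \<omega>) =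
      (\<Sum>j=2..N. offdiag (coef ?d j) j \<omega>)" for \<omega>
    by (simp add: sum_subtractf[symmetric])
  have "(L2_norm M (\<lambda>\<omega>. \<Sum>j=2..N. offdiag (coef ?d j) j \<omega>))\<^sup>2 \<le> (L2_norm (\<mu> \<Otimes>\<^sub>M \<mu>) ?d)\<^sup>2"
    unfolding offdiag_partial_norm by (rule offdiag_Bessel[OF L2_diff[OF f g]])
  then show "L2_norm M (\<lambda>\<omega>. (\<Sum>j=2..N. offdiag (coef f j) j \<omega>) - (\<Sum>j=2..N. offdiag (coef g j) j \<omega>))
      \<le> L2_norm (\<mu> \<Otimes>\<^sub>M \<mu>) ?d"
    unfolding eq by (rule power2_le_imp_le) simp
qed

text \<open>The argument of \<open>phi11_diff_norm\<close>, with a factor \<open>sqrt K\<close>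
  inherited from \<open>diag_partial_norm\<close>.\<close>

lemma phi2_diff_norm:
  assumes f: "f \<in> L2 (\<mu> \<Otimes>\<^sub>M \<mu>)" and g: "g \<in> L2 (\<mu> \<Otimes>\<^sub>M \<mu>)"
  shows "L2_norm M (\<lambda>\<omega>. phi2 M X \<mu> e f \<omega> - phi2 M X \<mu> e g \<omega>)
    \<le> sqrt K * L2_norm (\<mu> \<Otimes>\<^sub>M \<mu>) (\<lambda>z. f z - g z)"
proof (rule L2_tendsto_norm_bounded[OF L2_tendsto_diff[OF phi2_tendsto phi2_tendsto, OF f g]])
  fix N
  let ?d = "\<lambda>z. f z - g z"
  have eq: "(\<Sum>j=1..N. coef f j j * ((X j \<omega>)\<^sup>2 - 1)) - (\<Sum>j=1..N. coef g j j * ((X j \<omega>)\<^sup>2 - 1)) =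
      (\<Sum>j=1..N. coef ?d j j * ((X j \<omega>)\<^sup>2 - 1))" for \<omega>
    unfolding sum_subtractf[symmetric]
    by (intro sum.cong refl) (simp add: coef_diff[OF f g] left_diff_distrib)
  have "(L2_norm M (\<lambda>\<omega>. \<Sum>j=1..N. coef ?d j j * ((X j \<omega>)\<^sup>2 - 1)))\<^sup>2 \<le> K * (\<Sum>j=1..N. (coef ?d j j)\<^sup>2)"
    by (rule diag_partial_norm)
  also have "\<dots> \<le> K * (L2_norm (\<mu> \<Otimes>\<^sub>M \<mu>) ?d)\<^sup>2"
    by (intro mult_left_mono diag_Bessel L2_diff f g K_nonneg)
  also have "\<dots> = (sqrt K * L2_norm (\<mu> \<Otimes>\<^sub>M \<mu>) ?d)\<^sup>2"
    using K_nonneg by (simp add: power_mult_distrib)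
  finally show "L2_norm M (\<lambda>\<omega>. (\<Sum>j=1..N. coef f j j * ((X j \<omega>)\<^sup>2 - 1)) - (\<Sum>j=1..N. coef g j j * ((X j \<omega>)\<^sup>2 - 1)))
      \<le> sqrt K * L2_norm (\<mu> \<Otimes>\<^sub>M \<mu>) ?d"
    unfolding eq by (rule power2_le_imp_le) (use K_nonneg in simp)
qed

lemma phi11_continuous:
  assumes "L2_tendsto (\<mu> \<Otimes>\<^sub>M \<mu>) F f"
  shows "L2_tendsto M (\<lambda>n. phi11 M X \<mu> e (F n)) (phi11 M X \<mu> e f)"
proof -
  note F = L2_tendstoD[OF assms]
  have "(\<lambda>n. L2_norm M (\<lambda>\<omega>. phi11 M X \<mu> e (F n) \<omega> - phi11 M X \<mu> e f \<omega>)) \<longlonglongrightarrow> 0"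
    by (rule LIMSEQ_zero_bounded[OF L2_norm_nonneg phi11_diff_norm F(3)]) (use F in auto)
  then show ?thesis
    using L2_tendstoD(2)[OF phi11_tendsto] F by (simp add: L2_tendsto_def)
qed

lemma phi2_continuous:
  assumes "L2_tendsto (\<mu> \<Otimes>\<^sub>M \<mu>) F f"
  shows "L2_tendsto M (\<lambda>n. phi2 M X \<mu> e (F n)) (phi2 M X \<mu> e f)"
proof -
  note F = L2_tendstoD[OF assms]
  have "(\<lambda>n. L2_norm M (\<lambda>\<omega>. phi2 M X \<mu> e (F n) \<omega> - phi2 M X \<mu> e f \<omega>)) \<longlonglongrightarrow> 0"
    by (rule LIMSEQ_zero_bounded[OF L2_norm_nonneg phi2_diff_norm])
      (use F tendsto_mult_right_zero[OF F(3)] in auto)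
  then show ?thesis
    using L2_tendstoD(2)[OF phi2_tendsto] F by (simp add: L2_tendsto_def)
qed

text \<open>
  The partial sums of the two sides differ by partial sums of \<open>L2_inner \<mu> (h i) (g i) = 0\<close>.
  The products on the left converge only in \<open>L\<^sup>1\<close>, which is enough to identify
  the limits almost everywhere.
\<close>

lemma sum_Phi_products:
  fixes h g :: "'i \<Rightarrow> 'a \<Rightarrow> real"
  assumes h: "\<And>i. i \<in> I \<Longrightarrow> h i \<in> L2 \<mu>" and g: "\<And>i. i \<in> I \<Longrightarrow> g i \<in> L2 \<mu>"
    and orth: "\<And>i. i \<in> I \<Longrightarrow> L2_inner \<mu> (h i) (g i) = 0"
  defines "S \<equiv> \<lambda>z. \<Sum>i\<in>I. tensor (h i) (g i) z"
  shows "AE \<omega> in M. (\<Sum>i\<in>I. Phi M X \<mu> e (h i) \<omega> * Phi M X \<mu> e (g i) \<omega>) =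
    phi11 M X \<mu> e (\<lambda>z. S z + S (prod.swap z)) \<omega> + phi2 M X \<mu> e S \<omega>"
proof -
  let ?S' = "\<lambda>z. \<Sum>i\<in>I. tensor (g i) (h i) z"
  have swap: "S (prod.swap z) = ?S' z" for z
    unfolding S_def by (intro sum.cong refl) (simp add: tensor_def case_prod_beta')
  let ?u = "\<lambda>z. S z + S (prod.swap z)"
  define W where "W \<omega> = phi11 M X \<mu> e ?u \<omega> + phi2 M X \<mu> e S \<omega>" for \<omega>
  define F where "F \<omega> = (\<Sum>i\<in>I. Phi M X \<mu> e (h i) \<omega> * Phi M X \<mu> e (g i) \<omega>)" for \<omega>
  define a where "a i j = L2_inner \<mu> (h i) (e j)" for i j
  define b where "b i j = L2_inner \<mu> (g i) (e j)" for i j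
  define \<Phi> where "\<Phi> c N \<omega> = (\<Sum>k=1..N. c k * X k \<omega>)" for c and N :: nat and \<omega>
  define Q where "Q N \<omega> = (\<Sum>j=2..N. offdiag (coef ?u j) j \<omega>) + (\<Sum>j=1..N. coef S j j * ((X j \<omega>)\<^sup>2 - 1))" for N \<omega>
  \<comment> \<open>The constant left by centring the squares at stage \<open>N\<close>: a partial
    Parseval sum for each \<open>i\<close>.\<close>
  define r where "r N = (\<Sum>i\<in>I. \<Sum>j=1..N. a i j * b i j)" for N
  have S_L2: "S \<in> L2 (\<mu> \<Otimes>\<^sub>M \<mu>)" "?S' \<in> L2 (\<mu> \<Otimes>\<^sub>M \<mu>)"
    unfolding S_def using h g by (auto intro!: L2_sum EE.tensor_L2)
  have u_L2: "?u \<in> L2 (\<mu> \<Otimes>\<^sub>M \<mu>)"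
    unfolding swap by (intro L2_add S_L2)
  have coef_S: "coef S j k = (\<Sum>i\<in>I. a i j * b i k)" "coef ?S' j k = (\<Sum>i\<in>I. b i j * a i k)"
    if "1 \<le> j" "1 \<le> k" for j k
  proof -
    have "coef S j k = (\<Sum>i\<in>I. coef (tensor (h i) (g i)) j k)"
        "coef ?S' j k = (\<Sum>i\<in>I. coef (tensor (g i) (h i)) j k)"
      unfolding coef_def S_def using h g that by (auto intro!: L2_inner_sum_left EE.tensor_L2 ee_L2)
    then show "coef S j k = (\<Sum>i\<in>I. a i j * b i k)" "coef ?S' j k = (\<Sum>i\<in>I. b i j * a i k)"
      using h g that by (simp_all add: coef_tensor a_def b_def)
  qed
  \<comment> \<open>Symmetrising the kernel produces both crossed products, as in the off-diagonal
    part of \<open>linear_chaos_product\<close>.\<close>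
  have coef_u: "coef ?u j k = (\<Sum>i\<in>I. a i j * b i k + b i j * a i k)" if "1 \<le> j" "1 \<le> k" for j k
  proof -
    have "coef ?u j k = coef S j k + coef ?S' j k"
      unfolding coef_def swap using S_L2 that by (intro L2_inner_add_left ee_L2)
    then show ?thesis using that by (simp add: coef_S sum.distrib)
  qed
  have product: "(\<Sum>i\<in>I. \<Phi> (a i) N \<omega> * \<Phi> (b i) N \<omega>) = Q N \<omega> + r N" for N \<omega>
  proof -
    have off: "offdiag (coef ?u j) j \<omega> =
        (\<Sum>i\<in>I. (\<Sum>k=1..j-1. (a i j * b i k + b i j * a i k) * X k \<omega>) * X j \<omega>)" if "j \<ge> 1" for j
    proof -
      have "(\<Sum>k=1..j-1. coef ?u j k * X k \<omega>) =
          (\<Sum>k=1..j-1. \<Sum>i\<in>I. (a i j * b i k + b i j * a i k) * X k \<omega>)"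
        using that by (intro sum.cong refl) (simp add: coef_u sum_distrib_right)
      also have "\<dots> = (\<Sum>i\<in>I. \<Sum>k=1..j-1. (a i j * b i k + b i j * a i k) * X k \<omega>)"
        by (rule sum.swap)
      finally show ?thesis by (simp add: offdiag_def sum_distrib_right)
    qed
    have 1: "(\<Sum>j=2..N. offdiag (coef ?u j) j \<omega>) =
        (\<Sum>i\<in>I. \<Sum>j=2..N. (\<Sum>k=1..j-1. (a i j * b i k + b i j * a i k) * X k \<omega>) * X j \<omega>)"
      by (subst sum.swap) (intro sum.cong refl off, simp)
    have "(\<Sum>j=1..N. coef S j j * ((X j \<omega>)\<^sup>2 - 1)) =
        (\<Sum>j=1..N. \<Sum>i\<in>I. a i j * b i j * ((X j \<omega>)\<^sup>2 - 1))"
      by (intro sum.cong refl) (simp add: coef_S sum_distrib_right)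
    also have "\<dots> = (\<Sum>i\<in>I. \<Sum>j=1..N. a i j * b i j * ((X j \<omega>)\<^sup>2 - 1))"
      by (rule sum.swap)
    finally show ?thesis
      unfolding \<Phi>_def linear_chaos_product Q_def r_def 1 by (simp only: sum.distrib)
  qed
  have Phi: "L2_tendsto M (\<Phi> (a i)) (Phi M X \<mu> e (h i))" "L2_tendsto M (\<Phi> (b i)) (Phi M X \<mu> e (g i))"
    if "i \<in> I" for i
    using Phi_tendsto[OF h[OF that]] Phi_tendsto[OF g[OF that]] by (simp_all add: \<Phi>_def[abs_def] a_def b_def)
  have int_F: "integrable M F"
    unfolding F_def using Phi by (intro Bochner_Integration.integrable_sum L2_mult_integrable L2_tendstoD(2)) auto
  have Q: "L2_tendsto M Q W"
    unfolding Q_def[abs_def] W_def[abs_def]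
    by (intro L2_tendsto_add phi11_tendsto phi2_tendsto u_L2 S_L2)
  note QD = L2_tendstoD[OF Q]
  have int_W: "integrable M W" using QD by (intro L2_integrable)
  have r: "r \<longlonglongrightarrow> 0"
  proof -
    have "r \<longlonglongrightarrow> (\<Sum>i\<in>I. L2_inner \<mu> (h i) (g i))"
      unfolding r_def[abs_def] a_def b_def
      by (intro tendsto_sum hilbert_basis_Parseval[OF basis] h g)
    then show ?thesis using orth by simp
  qed
  \<comment> \<open>Inserting the exact identity \<open>product\<close> between \<open>F\<close> and
    \<open>W\<close> leaves three errors: that of the products in L1, that of the chaos series in
    L2, and the constant \<open>r N\<close>.\<close>
  have bound: "(\<integral>\<omega>. \<bar>F \<omega> - W \<omega>\<bar> \<partial>M) \<le>
      (\<Sum>i\<in>I. \<integral>\<omega>. \<bar>\<Phi> (a i) N \<omega> * \<Phi> (b i) N \<omega> - Phi M X \<mu> e (h i) \<omega> * Phi M X \<mu> e (g i) \<omega>\<bar> \<partial>M)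
      + L2_norm M (\<lambda>\<omega>. Q N \<omega> - W \<omega>) + \<bar>r N\<bar>" for N
  proof -
    let ?D = "\<lambda>i \<omega>. \<Phi> (a i) N \<omega> * \<Phi> (b i) N \<omega> - Phi M X \<mu> e (h i) \<omega> * Phi M X \<mu> e (g i) \<omega>"
    have int_D: "integrable M (?D i)" if "i \<in> I" for i
      using L2_tendstoD[OF Phi(1)[OF that]] L2_tendstoD[OF Phi(2)[OF that]]
      by (intro Bochner_Integration.integrable_diff L2_mult_integrable)
    have int_Q: "integrable M (\<lambda>\<omega>. Q N \<omega> - W \<omega>)"
      using QD by (intro L2_integrable L2_diff)
    have "\<bar>F \<omega> - W \<omega>\<bar> \<le> (\<Sum>i\<in>I. \<bar>?D i \<omega>\<bar>) + \<bar>Q N \<omega> - W \<omega>\<bar> + \<bar>r N\<bar>" for \<omega>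
    proof -
      have "F \<omega> - W \<omega> = (Q N \<omega> - W \<omega>) + r N - (\<Sum>i\<in>I. ?D i \<omega>)"
        unfolding F_def sum_subtractf product by simp
      then show ?thesis
        using sum_abs[of "\<lambda>i. ?D i \<omega>" I] by linarith
    qed
    then have "(\<integral>\<omega>. \<bar>F \<omega> - W \<omega>\<bar> \<partial>M) \<le> (\<integral>\<omega>. (\<Sum>i\<in>I. \<bar>?D i \<omega>\<bar>) + \<bar>Q N \<omega> - W \<omega>\<bar> + \<bar>r N\<bar> \<partial>M)"
      using int_F int_W int_D int_Q
      by (intro integral_mono) (auto intro!: Bochner_Integration.integrable_add Bochner_Integration.integrable_sum integrable_abs)
    also have "\<dots> = (\<Sum>i\<in>I. \<integral>\<omega>. \<bar>?D i \<omega>\<bar> \<partial>M) + (\<integral>\<omega>. \<bar>Q N \<omega> - W \<omega>\<bar> \<partial>M) + \<bar>r N\<bar>"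
      using int_D int_Q
      by (simp add: Bochner_Integration.integral_add Bochner_Integration.integral_sum prob_space
          Bochner_Integration.integrable_sum integrable_abs del: sum_abs)
    finally show ?thesis
      using L1_le_L2_norm[OF L2_diff[OF QD(1,2)], of N] by linarith
  qed
  have "(\<lambda>N. (\<Sum>i\<in>I. \<integral>\<omega>. \<bar>\<Phi> (a i) N \<omega> * \<Phi> (b i) N \<omega> - Phi M X \<mu> e (h i) \<omega> * Phi M X \<mu> e (g i) \<omega>\<bar> \<partial>M)
      + L2_norm M (\<lambda>\<omega>. Q N \<omega> - W \<omega>) + \<bar>r N\<bar>) \<longlonglongrightarrow> (\<Sum>i\<in>I. 0) + 0 + \<bar>0\<bar>"
    by (intro tendsto_add tendsto_sum L2_tendsto_mult_L1 Phi QD(3) tendsto_rabs r)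
  then have "(\<integral>\<omega>. \<bar>F \<omega> - W \<omega>\<bar> \<partial>M) \<le> (\<Sum>i\<in>I. 0) + 0 + \<bar>0\<bar>"
    using bound by (intro LIMSEQ_le_const) auto
  then have "(\<integral>\<omega>. \<bar>F \<omega> - W \<omega>\<bar> \<partial>M) = 0"
    by (intro antisym Bochner_Integration.integral_nonneg) auto
  then have "AE \<omega> in M. \<bar>F \<omega> - W \<omega>\<bar> = 0"
    using int_F int_W by (subst (asm) integral_nonneg_eq_0_iff_AE) auto
  then show ?thesis
    unfolding F_def W_def by eventually_elim simp
qed

end

subsection \<open>Staircase kernels\<close>

text \<open>The cut-off by which the Riemann sum multiplies \<open>tensor h g\<close>: for a
  partition, the indicator of a union of rectangles inside \<open>C_upper\<close>. It is kept as a
  sum so that each summand matches one tensor.\<close>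

definition "staircase t n = (\<lambda>(x, y). \<Sum>k<n. indicat_real {0<..t k} x * indicat_real {t k<..t (Suc k)} y)"

lemma partition_mono:
  fixes t :: "nat \<Rightarrow> real"
  assumes "\<And>k. k < n \<Longrightarrow> t k < t (Suc k)" "i \<le> j" "j \<le> n"
  shows "t i \<le> t j"
  using assms(2,3)
proof (induction j rule: dec_induct)
  case (step m)
  then show ?case using assms(1)[of m] by simp
qed simp

lemma partition_cell:
  fixes t :: "nat \<Rightarrow> real"
  assumes "t 0 < y" "y \<le> t n"
  obtains k where "k < n" "t k < y" "y \<le> t (Suc k)"
proof -
  \<comment> \<open>The least such index is positive because \<open>t 0 < y\<close>, and minimality
    makes its predecessor the left end of the cell.\<close>
  define m where "m = (LEAST m. y \<le> t m)"
  have m: "y \<le> t m" "m \<le> n"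
    unfolding m_def using assms(2) by (auto intro: LeastI Least_le)
  then obtain k where k: "m = Suc k"
    using assms(1) by (cases m) auto
  then have "\<not> y \<le> t k"
    unfolding m_def by (metis lessI not_less_Least)
  then show ?thesis
    using that[of k] k m by simp
qed

text \<open>Half-open cells are pairwise disjoint, so a single summand survives for a given
  \<open>y\<close>.\<close>

lemma staircase_cell:
  fixes t :: "nat \<Rightarrow> real"
  assumes inc: "\<And>k. k < n \<Longrightarrow> t k < t (Suc k)"
    and k: "k < n" "t k < y" "y \<le> t (Suc k)"
  shows "staircase t n (x, y) = indicator {0<..t k} x"
proof -
  have "indicat_real {t i<..t (Suc i)} y = 0" if "i < n" "i \<noteq> k" for i
  proof (cases "i < k")
    case True
    then show ?thesis
      using partition_mono[of n t "Suc i" k] inc k by simp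
  next
    case False
    then show ?thesis
      using partition_mono[of n t "Suc k" i] inc k that by simp
  qed
  then have "(\<Sum>i<n. indicat_real {0<..t i} x * indicat_real {t i<..t (Suc i)} y) =
      (\<Sum>i\<in>{k}. indicat_real {0<..t i} x * indicat_real {t i<..t (Suc i)} y)"
    using k(1) by (intro sum.mono_neutral_right) auto
  then show ?thesis
    using k by (simp add: staircase_def)
qed

text \<open>Points with \<open>x \<le> t k\<close> and \<open>t k < y\<close> satisfy
  \<open>x < y\<close>. The bound serves twice: it makes the staircase vanish off
  \<open>C_upper\<close>, and it provides the domination of the kernels.\<close>

lemma staircase_bounds:
  fixes t :: "nat \<Rightarrow> real"
  assumes inc: "\<And>k. k < n \<Longrightarrow> t k < t (Suc k)" and t: "t 0 = 0" "t n = 1"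
  shows "0 \<le> staircase t n z \<and> staircase t n z \<le> indicator C_upper z"
proof (cases z)
  case (Pair x y)
  show ?thesis
  proof (cases "0 < y \<and> y \<le> 1")
    case True
    then obtain k where k: "k < n" "t k < y" "y \<le> t (Suc k)"
      using partition_cell[of t y n] t by auto
    show ?thesis
      unfolding Pair using staircase_cell[OF inc k] k True
      by (auto simp: C_upper_def indicator_def)
  next
    case False
    have "indicat_real {t k<..t (Suc k)} y = 0" if "k < n" for k
      using partition_mono[of n t 0 k] partition_mono[of n t "Suc k" n] inc t that False
      by (auto simp: indicator_def)
    then have "staircase t n z = 0"
      unfolding Pair staircase_def prod.case by (intro sum.neutral) auto
    then show ?thesis by simp
  qed
qed

text \<open>Once the mesh is below \<open>y - x\<close>, the cell containing \<open>y\<close> starts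
  at or after \<open>x\<close>, so the staircase is 1 there. The axis is excluded because
  \<open>C_upper\<close> contains the points \<open>(0, y)\<close> with
  \<open>0 < y \<le> 1\<close>, where every staircase is 0.\<close>

lemma staircase_tendsto:
  fixes t :: "nat \<Rightarrow> nat \<Rightarrow> real"
  assumes t: "\<And>n. n \<ge> 1 \<Longrightarrow> t n 0 = 0" "\<And>n. n \<ge> 1 \<Longrightarrow> t n n = 1"
    and inc: "\<And>n k. n \<ge> 1 \<Longrightarrow> k < n \<Longrightarrow> t n k < t n (Suc k)"
    and mesh: "(\<lambda>n. Max ((\<lambda>k. t n (Suc k) - t n k) ` {..<n})) \<longlonglongrightarrow> 0"
    and x: "fst z \<noteq> 0"
  shows "(\<lambda>n. staircase (t n) n z) \<longlonglongrightarrow> indicator C_upper z"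
proof (cases "z \<in> C_upper")
  case False
  have "staircase (t n) n z = 0" if "n \<ge> 1" for n
    using staircase_bounds[of n "t n" z] t inc that False by force
  then have "\<forall>\<^sub>F n in sequentially. staircase (t n) n z = 0"
    by (intro eventually_sequentiallyI[of 1]) auto
  then show ?thesis
    using False by (simp add: tendsto_eventually)
next
  case True
  obtain x y where z: "z = (x, y)" by (cases z)
  have xy: "0 < x" "x < y" "y \<le> 1" using True x by (auto simp: z C_upper_def)
  have "\<forall>\<^sub>F n in sequentially. Max ((\<lambda>k. t n (Suc k) - t n k) ` {..<n}) < y - x"
    using xy by (intro order_tendstoD(2)[OF mesh]) auto
  then have "\<forall>\<^sub>F n in sequentially. staircase (t n) n z = 1"
    using eventually_ge_at_top[of 1]
  proof eventually_elim
    case (elim n)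
    obtain k where k: "k < n" "t n k < y" "y \<le> t n (Suc k)"
      using partition_cell[of "t n" y n] t elim(2) xy by auto
    have "t n (Suc k) - t n k \<le> Max ((\<lambda>k. t n (Suc k) - t n k) ` {..<n})"
      using k by (intro Max_ge) auto
    then have "x \<le> t n k" using k elim by linarith
    then show ?case
      using staircase_cell[of n "t n" k y x] inc elim(2) k xy by (simp add: z)
  qed
  then show ?thesis
    using True by (simp add: tendsto_eventually)
qed

lemma kernel_tendsto:
  fixes \<mu> :: "real measure" and t :: "nat \<Rightarrow> nat \<Rightarrow> real"
  assumes "prob_space \<mu>" and sets[measurable_cong]: "sets \<mu> = sets borel"
    and diffuse: "\<And>x. emeasure \<mu> {x} = 0"
    and h: "h \<in> L2 \<mu>" and g: "g \<in> L2 \<mu>"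
    and t: "\<And>n. n \<ge> 1 \<Longrightarrow> t n 0 = 0" "\<And>n. n \<ge> 1 \<Longrightarrow> t n n = 1"
    and inc: "\<And>n k. n \<ge> 1 \<Longrightarrow> k < n \<Longrightarrow> t n k < t n (Suc k)"
    and mesh: "(\<lambda>n. Max ((\<lambda>k. t n (Suc k) - t n k) ` {..<n})) \<longlonglongrightarrow> 0"
  shows "L2_tendsto (\<mu> \<Otimes>\<^sub>M \<mu>)
    (\<lambda>n z. \<Sum>k<n. tensor (\<lambda>x. h x * indicator {0<..t n k} x) (\<lambda>x. g x * indicator {t n k<..t n (Suc k)} x) z)
    (\<lambda>z. tensor h g z * indicator C_upper z)"
proof -
  interpret prob_space \<mu> by fact
  interpret P: pair_prob_space \<mu> \<mu> by unfold_locales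
  let ?T = "tensor h g" and ?f = "\<lambda>z. tensor h g z * indicator C_upper z"
  define F where "F n z = ( \<Sum>k<n. tensor (\<lambda>x. h x * indicator {0<..t n k} x) (\<lambda>x. g x * indicator {t n k<..t n (Suc k)} x) z)" for n z
  \<comment> \<open>This confines \<open>n\<close> to a factor between 0 and 1 in front of a fixed
    kernel.\<close>
  have F_eq: "F n z = ?T z * staircase (t n) n z" for n z
    unfolding F_def staircase_def tensor_def case_prod_beta' sum_distrib_left
    by (intro sum.cong refl) (simp only: ac_simps)
  \<comment> \<open>Measurability is checked in the Borel product and transported along
    \<open>sets \<mu> = sets borel\<close>.\<close>
  have "{z \<in> space (borel \<Otimes>\<^sub>M borel). 0 \<le> fst z \<and> fst z < snd z \<and> snd z \<le> (1::real)} \<in> sets (borel \<Otimes>\<^sub>M borel)"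
    by measurable
  moreover have "{z \<in> space (borel \<Otimes>\<^sub>M borel). 0 \<le> fst z \<and> fst z < snd z \<and> snd z \<le> (1::real)} = C_upper"
    by (auto simp: C_upper_def space_pair_measure)
  ultimately have C: "C_upper \<in> sets (\<mu> \<Otimes>\<^sub>M \<mu>)"
    using sets_pair_measure_cong[OF sets sets] by simp
  have T: "?T \<in> L2 (\<mu> \<Otimes>\<^sub>M \<mu>)" using h g by (rule P.tensor_L2)
  have f: "?f \<in> L2 (\<mu> \<Otimes>\<^sub>M \<mu>)" using T C by (rule L2_mult_indicator)
  have F: "F n \<in> L2 (\<mu> \<Otimes>\<^sub>M \<mu>)" for n
    unfolding F_def[abs_def] using h g sets by (intro L2_sum P.tensor_L2 L2_mult_indicator) auto
  have "AE x in \<mu>. x \<noteq> 0"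
    using diffuse[of 0] sets by (intro AE_I[of _ _ "{0}"]) auto
  then have AE0: "AE z in \<mu> \<Otimes>\<^sub>M \<mu>. fst z \<noteq> 0"
    by (intro P.AE_pair_measure) auto
  \<comment> \<open>The index is shifted because the bounds on the staircase need a partition, hence \<open>n \<ge> 1\<close>.\<close>
  have "(\<lambda>n. \<integral>z. (F (Suc n) z - ?f z)\<^sup>2 \<partial>(\<mu> \<Otimes>\<^sub>M \<mu>)) \<longlonglongrightarrow> (\<integral>z. 0 \<partial>(\<mu> \<Otimes>\<^sub>M \<mu>))"
  proof (rule integral_dominated_convergence[where w="\<lambda>z. (?T z)\<^sup>2"])
    show "(\<lambda>z. (F (Suc n) z - ?f z)\<^sup>2) \<in> borel_measurable (\<mu> \<Otimes>\<^sub>M \<mu>)" for n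
      using L2_measurable[OF L2_diff[OF F f]] by simp
    show "AE z in \<mu> \<Otimes>\<^sub>M \<mu>. (\<lambda>n. (F (Suc n) z - ?f z)\<^sup>2) \<longlonglongrightarrow> 0"
      using AE0
    proof eventually_elim
      case (elim z)
      have "(\<lambda>n. staircase (t (Suc n)) (Suc n) z) \<longlonglongrightarrow> indicator C_upper z"
        by (rule LIMSEQ_Suc[OF staircase_tendsto[OF t inc mesh elim]])
      then have "(\<lambda>n. (?T z * staircase (t (Suc n)) (Suc n) z - ?f z)\<^sup>2) \<longlonglongrightarrow> (?T z * indicator C_upper z - ?f z)\<^sup>2"
        by (intro tendsto_intros)
      then show ?case by (simp add: F_eq)
    qed
    show "AE z in \<mu> \<Otimes>\<^sub>M \<mu>. norm ((F (Suc n) z - ?f z)\<^sup>2) \<le> (?T z)\<^sup>2" for n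
    proof (rule AE_I2)
      fix z
      let ?s = "staircase (t (Suc n)) (Suc n) z"
      have "0 \<le> ?s \<and> ?s \<le> indicator C_upper z"
        using t inc by (intro staircase_bounds) auto
      \<comment> \<open>Both functions take values between 0 and 1, which is why the dominating
        function carries no constant.\<close>
      then have "\<bar>?s - indicator C_upper z\<bar> \<le> 1"
        by (auto simp: indicator_def split: if_splits)
      then have "(?s - indicator C_upper z)\<^sup>2 \<le> 1"
        by (simp add: abs_square_le_1)
      then have "(?T z)\<^sup>2 * (?s - indicator C_upper z)\<^sup>2 \<le> (?T z)\<^sup>2"
        by (simp add: mult_left_le)
      then show "norm ((F (Suc n) z - ?f z)\<^sup>2) \<le> (?T z)\<^sup>2"
        by (simp only: F_eq right_diff_distrib[symmetric] power_mult_distrib real_norm_def abs_power2 abs_mult)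
    qed
  qed (use L2_square_integrable[OF T] in auto)
  then have "(\<lambda>n. sqrt (\<integral>z. (F (Suc n) z - ?f z)\<^sup>2 \<partial>(\<mu> \<Otimes>\<^sub>M \<mu>))) \<longlonglongrightarrow> sqrt 0"
    by (intro tendsto_real_sqrt) simp
  then have "(\<lambda>n. L2_norm (\<mu> \<Otimes>\<^sub>M \<mu>) (\<lambda>z. F (Suc n) z - ?f z)) \<longlonglongrightarrow> 0"
    by (simp add: L2_norm_def L2_inner_def power2_eq_square)
  then have "(\<lambda>n. L2_norm (\<mu> \<Otimes>\<^sub>M \<mu>) (\<lambda>z. F n z - ?f z)) \<longlonglongrightarrow> 0"
    by (rule LIMSEQ_imp_Suc)
  then show ?thesis
    using F f by (simp add: L2_tendsto_def F_def[abs_def])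
qed

text \<open>The moment bound is a statement in \<open>ennreal\<close>: its finiteness must first
  give integrability before the expectation can be compared with \<open>K\<close>. Mean zero
  identifies the variance with the second moment.\<close>

lemma noise_of_moments:
  fixes \<nu> :: "'e measure"
  assumes "prob_space \<nu>"
    and indep: "prob_space.indep_vars \<nu> (\<lambda>_. borel) X {1..}"
    and mean: "\<And>k. k \<ge> 1 \<Longrightarrow> prob_space.expectation \<nu> (X k) = 0"
    and var: "\<And>k. k \<ge> 1 \<Longrightarrow> prob_space.variance \<nu> (X k) = 1"
    and moment: "(SUP k\<in>{1..}. \<integral>\<^sup>+\<omega>. ennreal (\<bar>X k \<omega>\<bar> powr 4) \<partial>\<nu>) < ennreal K"
  shows "noise \<nu> X K"
proof -
  interpret prob_space \<nu> by fact
  have "integrable \<nu> (\<lambda>\<omega>. X k \<omega> ^ 4) \<and> expectation (\<lambda>\<omega>. X k \<omega> ^ 4) \<le> K" if k: "k \<ge> 1" for k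
  proof -
    have [measurable]: "X k \<in> borel_measurable \<nu>"
      using indep k by (auto simp: indep_vars_def)
    \<comment> \<open>At 0 both sides vanish, the left one by the convention for
      \<open>powr\<close>.\<close>
    have "\<bar>x\<bar> powr 4 = x ^ 4" for x :: real
      using powr_realpow[of "\<bar>x\<bar>" 4] by (cases "x = 0") simp_all
    then have "(\<integral>\<^sup>+\<omega>. ennreal (X k \<omega> ^ 4) \<partial>\<nu>) \<le> (SUP k\<in>{1..}. \<integral>\<^sup>+\<omega>. ennreal (\<bar>X k \<omega>\<bar> powr 4) \<partial>\<nu>)"
      using k by (intro SUP_upper2[of k]) auto
    then have less: "(\<integral>\<^sup>+\<omega>. ennreal (X k \<omega> ^ 4) \<partial>\<nu>) < ennreal K"
      using moment by (rule le_less_trans)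
    then have int: "integrable \<nu> (\<lambda>\<omega>. X k \<omega> ^ 4)"
      by (intro integrableI_bounded) (auto intro: less_trans)
    then have "ennreal (expectation (\<lambda>\<omega>. X k \<omega> ^ 4)) < ennreal K"
      using less by (subst (asm) nn_integral_eq_integral) auto
    then have "expectation (\<lambda>\<omega>. X k \<omega> ^ 4) < K"
      by (subst (asm) ennreal_less_iff) auto
    with int show ?thesis by simp
  qed
  then show ?thesis
    using indep mean var by unfold_locales auto
qed

theorem proposition6p2p2:
  fixes \<nu> :: "'e::real_normed_vector measure"
    and X :: "nat \<Rightarrow> 'e \<Rightarrow> real"
    and \<mu> :: "real measure"
    and e :: "nat \<Rightarrow> real \<Rightarrow> real"
    and h g :: "real \<Rightarrow> real"
    and t :: "nat \<Rightarrow> nat \<Rightarrow> real"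
  assumes "prob_space \<nu>" and "space \<nu> = UNIV"
    and "prob_space.indep_vars \<nu> (\<lambda>_. borel) X {1..}"
    and "\<And>k. k \<ge> 1 \<Longrightarrow> prob_space.expectation \<nu> (X k) = 0"
    and "\<And>k. k \<ge> 1 \<Longrightarrow> prob_space.variance \<nu> (X k) = 1"
    and "\<And>p::real. p > 1 \<Longrightarrow>
           \<exists>K::real. (SUP k\<in>{1..}. \<integral>\<^sup>+\<omega>. ennreal (\<bar>X k \<omega>\<bar> powr p) \<partial>\<nu>) < ennreal K"
    and "prob_space \<mu>" and "sets \<mu> = sets borel"
    and "\<And>x. emeasure \<mu> {x} = 0"
    and "hilbert_basis \<mu> e"
    and "h \<in> L2 \<mu>" and "g \<in> L2 \<mu>"
    and "\<And>n. n \<ge> 1 \<Longrightarrow> t n 0 = 0"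
    and "\<And>n. n \<ge> 1 \<Longrightarrow> t n n = 1"
    and "\<And>n k. n \<ge> 1 \<Longrightarrow> k < n \<Longrightarrow> t n k < t n (Suc k)"
    and "(\<lambda>n. Max ((\<lambda>k. t n (Suc k) - t n k) ` {..<n})) \<longlonglongrightarrow> 0"
  shows "L2_tendsto \<nu>
    (\<lambda>n \<omega>. \<Sum>k<n.
        Phi \<nu> X \<mu> e (\<lambda>x. h x * indicator {0<..t n k} x) \<omega> *
        Phi \<nu> X \<mu> e (\<lambda>x. g x * indicator {t n k<..t n (Suc k)} x) \<omega>)
    (\<lambda>\<omega>.
        phi11 \<nu> X \<mu> e
          (\<lambda>z. tensor h g z * indicator C_upper z + tensor g h z * indicator C_lower z) \<omega> +
        phi2 \<nu> X \<mu> e (\<lambda>z. tensor h g z * indicator C_upper z) \<omega>)"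
proof -
  \<comment> \<open>Exponent 4 is the one that bounds the centred squares of the \<open>X k\<close>
    in L2.\<close>
  have "(1::real) < 4" by simp
  from assms(6)[OF this] obtain K where K: "(SUP k\<in>{1..}. \<integral>\<^sup>+\<omega>. ennreal (\<bar>X k \<omega>\<bar> powr 4) \<partial>\<nu>) < ennreal K"
    by (rule exE)
  have noise: "noise \<nu> X K"
    by (rule noise_of_moments) (fact assms K)+
  interpret noise \<nu> X K by (rule noise)
  interpret chaos \<nu> X K \<mu> e
    by (rule chaos.intro[OF noise chaos_axioms.intro[OF assms(7,10)]])
  define hk where "hk n k x = h x * indicator {0<..t n k} x" for n k x
  define gk where "gk n k x = g x * indicator {t n k<..t n (Suc k)} x" for n k x
  define S where "S n z = (\<Sum>k<n. tensor (hk n k) (gk n k) z)" for n z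
  let ?f = "\<lambda>z. tensor h g z * indicator C_upper z"
  have L2: "hk n k \<in> L2 \<mu>" "gk n k \<in> L2 \<mu>" for n k
    unfolding hk_def[abs_def] gk_def[abs_def]
    by (rule L2_mult_indicator; simp add: assms(8,11,12))+
  have "hk n k x * gk n k x = 0" for n k x
    by (simp add: hk_def gk_def indicator_def)
  then have disjoint: "L2_inner \<mu> (hk n k) (gk n k) = 0" for n k
    by (simp only: L2_inner_def Bochner_Integration.integral_zero)
  have S: "L2_tendsto (\<mu> \<Otimes>\<^sub>M \<mu>) S ?f"
    using kernel_tendsto[OF assms(7-9,11-16)]
    by (simp add: S_def[abs_def] hk_def[abs_def] gk_def[abs_def])
  have u: "L2_tendsto (\<mu> \<Otimes>\<^sub>M \<mu>) (\<lambda>n z. S n z + S n (prod.swap z)) (\<lambda>z. ?f z + ?f (prod.swap z))"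
    by (intro L2_tendsto_add S L2_tendsto_swap E.sigma_finite_measure_axioms)
  \<comment> \<open>Swapping the coordinates exchanges \<open>h\<close> and \<open>g\<close> and
    reflects \<open>C_upper\<close> onto \<open>C_lower\<close>.\<close>
  have "?f (prod.swap z) = tensor g h z * indicator C_lower z" for z
    by (auto simp: tensor_def C_upper_def C_lower_def indicator_def split: prod.splits)
  then have lim: "L2_tendsto \<nu>
      (\<lambda>n \<omega>. phi11 \<nu> X \<mu> e (\<lambda>z. S n z + S n (prod.swap z)) \<omega> + phi2 \<nu> X \<mu> e (S n) \<omega>)
      (\<lambda>\<omega>. phi11 \<nu> X \<mu> e (\<lambda>z. ?f z + tensor g h z * indicator C_lower z) \<omega> + phi2 \<nu> X \<mu> e ?f \<omega>)"
    using L2_tendsto_add[OF phi11_continuous[OF u] phi2_continuous[OF S]] by simp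
  \<comment> \<open>Equality almost everywhere does not by itself transfer measurability, so
    \<open>L2_tendsto_cong_AE\<close> asks for it separately.\<close>
  have Phi_meas: "Phi \<nu> X \<mu> e (hk n k) \<in> borel_measurable \<nu>" "Phi \<nu> X \<mu> e (gk n k) \<in> borel_measurable \<nu>" for n k
    by (intro L2_measurable L2_tendstoD(2)[OF Phi_tendsto] L2)+
  have "L2_tendsto \<nu>
      (\<lambda>n \<omega>. \<Sum>k<n. Phi \<nu> X \<mu> e (hk n k) \<omega> * Phi \<nu> X \<mu> e (gk n k) \<omega>)
      (\<lambda>\<omega>. phi11 \<nu> X \<mu> e (\<lambda>z. ?f z + tensor g h z * indicator C_lower z) \<omega> + phi2 \<nu> X \<mu> e ?f \<omega>)"
  proof (rule L2_tendsto_cong_AE[OF lim])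
    show "(\<lambda>\<omega>. \<Sum>k<n. Phi \<nu> X \<mu> e (hk n k) \<omega> * Phi \<nu> X \<mu> e (gk n k) \<omega>) \<in> borel_measurable \<nu>" for n
      by (intro borel_measurable_sum borel_measurable_times Phi_meas)
    show "AE \<omega> in \<nu>. (\<Sum>k<n. Phi \<nu> X \<mu> e (hk n k) \<omega> * Phi \<nu> X \<mu> e (gk n k) \<omega>) =
        phi11 \<nu> X \<mu> e (\<lambda>z. S n z + S n (prod.swap z)) \<omega> + phi2 \<nu> X \<mu> e (S n) \<omega>" for n
      unfolding S_def[abs_def] by (rule sum_Phi_products[OF L2 disjoint])
  qed
  then show ?thesis
    by (simp add: hk_def[abs_def] gk_def[abs_def])
qed

end
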